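(* Fix a real $t\ge 0$ and an integer $k\ge1$, and let $J$ be a nonempty open interval contained in $\mathcal Z_t^{(2)}$. If $f:\mathbb R\to\mathbb R$ is finite and convex and $\mathcal K_{t,k}^T|f|(z)<\infty$ for every $z\in J$, then the map $z\mapsto\mathcal K_{t,k}^Tf(z)$ is convex on $J$.
   Context: Exponential family. Let $\nu$ be a $\sigma$-finite measure on $\mathbb R$, $N:=\{u\in\mathbb R:\int_{\mathbb R} e^{ux}\nu(dx)<\infty\}$, with interior $N^\circ$, and $B(u):=\log\int_{\mathbb R} e^{ux}\nu(dx)$. For $u\in N$ let $P_u(dx):=e^{ux-B(u)}\nu(dx)$, a probability measure. It is assumed that $B''(u)=\mathrm{Var}_{P_u}(X)>0$ on $N^\circ$ (nondegeneracy). Let $\mu$ be a probability measure on $\mathbb R$ (the prior of a parameter $\Theta$) with support $S:=\operatorname{supp}\mu\subseteq N^\circ$. Conditionally on $\Theta=u$, the observations $X_1,X_2,\dots$ are i.i.d. with law $P_u$. Let $T:S\to\mathbb R$ be non-decreasing, $\mu$-integrable and not $\mu$-a.s. constant. Interpolated posterior. For real $t\ge 0$ let $$\mathcal Y_t:=\Big\{y\in\mathbb R:\int_S(1+|T(u)|)e^{uy-tB(u)}\mu(du)<\infty\Big\},$$ and for $y\in\mathcal Y_t$ $$\mu_{t,y}(du):=\frac{e^{uy-tB(u)}\mu(du)}{\int_S e^{u'y-tB(u')}\mu(du')},\qquad \Lambda_t(y):=\int_S T(u)\,\mu_{t,y}(du).$$ The set $\mathcal Y_t$ is an interval and $\Lambda_t$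 is strictly increasing on it. Put $\mathcal Z_t:=\Lambda_t(\mathcal Y_t)$; for $z\in\mathcal Z_t$ let $y(t,z)\in\mathcal Y_t$ be the unique solution of $\Lambda_t(y(t,z))=z$, and $\mu_{t,z}:=\mu_{t,y(t,z)}$. Further, $$\mathcal Y_t^{(2)}:=\operatorname{int}\Big\{y\in\mathbb R:\int_S(1+|T(u)|)(1+u^2)e^{uy-tB(u)}\mu(du)<\infty\Big\},\qquad \mathcal Z_t^{(2)}:=\Lambda_t(\mathcal Y_t^{(2)}).$$ Transition kernel and operator. Fix $u_*\in N^\circ$. For an integer $k\ge1$ let $P_u^{(k)}$ be the law of $X_1+\cdots+X_k$ when $X_1,\dots,X_k$ are i.i.d. with law $P_u$, and $$\ell_k(u,x):=\frac{dP_u^{(k)}}{dP_{u_*}^{(k)}}(x)=\exp\{(u-u_* )x-k(B(u)-B(u_* ))\}.$$ For $z\in\mathcal Z_t$ set $\rho_{t,k}(z,x):=\int_S\ell_k(u,x)\mu_{t,z}(du)$, $\eta_{t,k}(z,x):=\int_S|T(u)|\ell_k(u,x)\mu_{t,z}(du)$, and $$M_{t,z}^{(k)}(x):=\frac{\int_S T(u)\ell_k(u,x)\mu_{t,z}(du)}{\rho_{t,k}(z,x)}\ \text{ if } 0<\rho_{t,k}(z,x)<\infty \text{ and } \eta_{t,k}(z,x)<\infty,\qquad M_{t,z}^{(k)}(x):=z\ \text{ otherwise.}$$ For Borel $C\subseteq\mathbb R$ and $z\in\mathcal Z_t$, $$K_{t,k}^T(z,C):=\int_{\mathbb R}\mathbf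 1_C\big(M_{t,z}^{(k)}(x)\big)\int_S P_u^{(k)}(dx)\,\mu_{t,z}(du),\qquad \mathcal K_{t,k}^Tf(z):=\int_{\mathbb R}f(w)\,K_{t,k}^T(z,dw).$$ *)

theory Defs
  imports "HOL-Probability.Probability"
begin

section \<open>Exponential family\<close>

definition nat_dom :: "real measure \<Rightarrow> real set" where
  "nat_dom \<nu> = {u. (\<integral>\<^sup>+ x. ennreal (exp (u * x)) \<partial>\<nu>) < \<infinity>}"

definition cumulant :: "real measure \<Rightarrow> real \<Rightarrow> real" where
  "cumulant \<nu> u = ln (\<integral>x. exp (u * x) \<partial>\<nu>)"

text \<open>The values of \<open>cumulant\<close> and \<open>exp_law\<close> are meaningful only for \<open>u \<in> nat_dom \<nu>\<close>.\<close>

definition exp_law :: "real measure \<Rightarrow> real \<Rightarrow> real measure" where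
  "exp_law \<nu> u = density \<nu> (\<lambda>x. ennreal (exp (u * x - cumulant \<nu> u)))"

text \<open>The law of \<open>X\<^sub>1 + \<dots> + X\<^sub>k\<close>, with the i.i.d. sample realised as the coordinates of a
  finite product space.\<close>

definition sum_law :: "real measure \<Rightarrow> nat \<Rightarrow> real \<Rightarrow> real measure" where
  "sum_law \<nu> k u =
     distr (Pi\<^sub>M {..<k} (\<lambda>_. exp_law \<nu> u)) borel (\<lambda>\<omega>. \<Sum>i<k. \<omega> i)"

text \<open>The pointwise version, defined for every \<open>x\<close>, of the Radon-Nikodym derivative of
  \<open>sum_law \<nu> k u\<close> with respect to \<open>sum_law \<nu> k us\<close>.\<close>

definition lik_ratio :: "real measure \<Rightarrow> real \<Rightarrow> nat \<Rightarrow> real \<Rightarrow> real \<Rightarrow> real" where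
  "lik_ratio \<nu> us k u x =
     exp ((u - us) * x - real k * (cumulant \<nu> u - cumulant \<nu> us))"


section \<open>Interpolated posterior\<close>

definition supp :: "real measure \<Rightarrow> real set" where
  "supp \<mu> = {u. \<forall>U. open U \<and> u \<in> U \<longrightarrow> emeasure \<mu> U > 0}"

definition tilt :: "real measure \<Rightarrow> real \<Rightarrow> real \<Rightarrow> real \<Rightarrow> real" where
  "tilt \<nu> t y u = exp (u * y - t * cumulant \<nu> u)"

text \<open>The function \<open>T\<close> is only given on \<open>supp \<mu>\<close>; its values elsewhere are arbitrary, so every
  integral involving it is taken over \<open>supp \<mu>\<close>.\<close>

definition Y_dom :: "real measure \<Rightarrow> real measure \<Rightarrow> (real \<Rightarrow> real) \<Rightarrow> real \<Rightarrow> real set" where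
  "Y_dom \<nu> \<mu> T t =
     {y. (\<integral>\<^sup>+ u\<in>supp \<mu>. ennreal ((1 + \<bar>T u\<bar>) * tilt \<nu> t y u) \<partial>\<mu>) < \<infinity>}"

definition Y2_dom :: "real measure \<Rightarrow> real measure \<Rightarrow> (real \<Rightarrow> real) \<Rightarrow> real \<Rightarrow> real set" where
  "Y2_dom \<nu> \<mu> T t = interior
     {y. (\<integral>\<^sup>+ u\<in>supp \<mu>. ennreal ((1 + \<bar>T u\<bar>) * (1 + u\<^sup>2) * tilt \<nu> t y u) \<partial>\<mu>) < \<infinity>}"

definition posterior_y :: "real measure \<Rightarrow> real measure \<Rightarrow> real \<Rightarrow> real \<Rightarrow> real measure" where
  "posterior_y \<nu> \<mu> t y = density \<mu> (\<lambda>u. ennreal (indicator (supp \<mu>) u * tilt \<nu> t y u /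
     (LINT u':supp \<mu>|\<mu>. tilt \<nu> t y u')))"

definition post_mean ::
    "real measure \<Rightarrow> real measure \<Rightarrow> (real \<Rightarrow> real) \<Rightarrow> real \<Rightarrow> real \<Rightarrow> real" where
  "post_mean \<nu> \<mu> T t y = (LINT u:supp \<mu>|posterior_y \<nu> \<mu> t y. T u)"

definition Z_dom :: "real measure \<Rightarrow> real measure \<Rightarrow> (real \<Rightarrow> real) \<Rightarrow> real \<Rightarrow> real set" where
  "Z_dom \<nu> \<mu> T t = post_mean \<nu> \<mu> T t ` Y_dom \<nu> \<mu> T t"

definition Z2_dom :: "real measure \<Rightarrow> real measure \<Rightarrow> (real \<Rightarrow> real) \<Rightarrow> real \<Rightarrow> real set" where
  "Z2_dom \<nu> \<mu> T t = post_mean \<nu> \<mu> T t ` Y2_dom \<nu> \<mu> T t"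

text \<open>Meaningful for \<open>z \<in> Z_dom \<nu> \<mu> T t\<close>, since \<open>post_mean \<nu> \<mu> T t\<close> is strictly increasing on
  \<open>Y_dom \<nu> \<mu> T t\<close>. The same restriction applies to everything below that depends on \<open>z\<close>.\<close>

definition y_of :: "real measure \<Rightarrow> real measure \<Rightarrow> (real \<Rightarrow> real) \<Rightarrow> real \<Rightarrow> real \<Rightarrow> real" where
  "y_of \<nu> \<mu> T t z = (THE y. y \<in> Y_dom \<nu> \<mu> T t \<and> post_mean \<nu> \<mu> T t y = z)"

definition posterior ::
    "real measure \<Rightarrow> real measure \<Rightarrow> (real \<Rightarrow> real) \<Rightarrow> real \<Rightarrow> real \<Rightarrow> real measure" where
  "posterior \<nu> \<mu> T t z = posterior_y \<nu> \<mu> t (y_of \<nu> \<mu> T t z)"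


section \<open>Transition kernel and operator\<close>

definition rho :: "real measure \<Rightarrow> real measure \<Rightarrow> (real \<Rightarrow> real) \<Rightarrow> real \<Rightarrow> real \<Rightarrow> nat \<Rightarrow>
    real \<Rightarrow> real \<Rightarrow> ennreal" where
  "rho \<nu> \<mu> T us t k z x =
     (\<integral>\<^sup>+ u\<in>supp \<mu>. ennreal (lik_ratio \<nu> us k u x) \<partial>posterior \<nu> \<mu> T t z)"

definition eta :: "real measure \<Rightarrow> real measure \<Rightarrow> (real \<Rightarrow> real) \<Rightarrow> real \<Rightarrow> real \<Rightarrow> nat \<Rightarrow>
    real \<Rightarrow> real \<Rightarrow> ennreal" where
  "eta \<nu> \<mu> T us t k z x =
     (\<integral>\<^sup>+ u\<in>supp \<mu>. ennreal (\<bar>T u\<bar> * lik_ratio \<nu> us k u x) \<partial>posterior \<nu> \<mu> T t z)"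

definition next_mean :: "real measure \<Rightarrow> real measure \<Rightarrow> (real \<Rightarrow> real) \<Rightarrow> real \<Rightarrow> real \<Rightarrow> nat \<Rightarrow>
    real \<Rightarrow> real \<Rightarrow> real" where
  "next_mean \<nu> \<mu> T us t k z x =
     (if 0 < rho \<nu> \<mu> T us t k z x \<and> rho \<nu> \<mu> T us t k z x < \<infinity> \<and> eta \<nu> \<mu> T us t k z x < \<infinity>
      then (LINT u:supp \<mu>|posterior \<nu> \<mu> T t z. T u * lik_ratio \<nu> us k u x) /
             enn2real (rho \<nu> \<mu> T us t k z x)
      else z)"

definition trans_prob :: "real measure \<Rightarrow> real measure \<Rightarrow> (real \<Rightarrow> real) \<Rightarrow> real \<Rightarrow> real \<Rightarrow> nat \<Rightarrow>
    real \<Rightarrow> real set \<Rightarrow> ennreal" where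
  "trans_prob \<nu> \<mu> T us t k z C =
     (\<integral>\<^sup>+ u\<in>supp \<mu>. (\<integral>\<^sup>+ x. indicator C (next_mean \<nu> \<mu> T us t k z x) \<partial>sum_law \<nu> k u)
        \<partial>posterior \<nu> \<mu> T t z)"

text \<open>The Borel measure \<open>C \<mapsto> trans_prob \<dots> z C\<close>.\<close>

definition trans_kernel :: "real measure \<Rightarrow> real measure \<Rightarrow> (real \<Rightarrow> real) \<Rightarrow> real \<Rightarrow> real \<Rightarrow> nat \<Rightarrow>
    real \<Rightarrow> real measure" where
  "trans_kernel \<nu> \<mu> T us t k z = measure_of UNIV (sets borel) (trans_prob \<nu> \<mu> T us t k z)"

definition trans_op :: "real measure \<Rightarrow> real measure \<Rightarrow> (real \<Rightarrow> real) \<Rightarrow> real \<Rightarrow> real \<Rightarrow> nat \<Rightarrow>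
    (real \<Rightarrow> real) \<Rightarrow> real \<Rightarrow> real" where
  "trans_op \<nu> \<mu> T us t k f z = (\<integral>w. f w \<partial>trans_kernel \<nu> \<mu> T us t k z)"

text \<open>The operator on nonnegative functions, with values in \<open>[0, \<infinity>]\<close>, so that finiteness can be
  expressed.\<close>

definition trans_op_nn :: "real measure \<Rightarrow> real measure \<Rightarrow> (real \<Rightarrow> real) \<Rightarrow> real \<Rightarrow> real \<Rightarrow> nat \<Rightarrow>
    (real \<Rightarrow> ennreal) \<Rightarrow> real \<Rightarrow> ennreal" where
  "trans_op_nn \<nu> \<mu> T us t k g z = (\<integral>\<^sup>+ w. g w \<partial>trans_kernel \<nu> \<mu> T us t k z)"

end

theory Submission
  imports Defs
begin

text \<open>
  In the coordinate \<open>y\<close> the interpolated posteriors form an exponential family: they are the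
  normalised tilts \<open>exp (u * y)\<close> of one base measure on \<open>S = supp \<mu>\<close>, and \<open>z\<close> is the mean of \<open>T\<close>
  under the tilt. This mean is strictly increasing in \<open>y\<close> because \<open>T\<close> is non-decreasing and not
  almost surely constant, so a comparison between points of \<open>J\<close> is a comparison between tilts.

  \<^bold>\<open>Reduction to hinges.\<close> The posterior mean of \<open>T\<close> is a martingale, so \<open>K(z, \<cdot>)\<close> has mean \<open>z\<close> and
  affine functions are mapped to affine functions. A convex \<open>f\<close> is a dominated limit of affine
  functions plus nonnegative combinations of hinges \<open>w \<mapsto> max 0 (w - c)\<close>
  (\<open>convex_on_integral_from_hinges\<close>). It remains to show that
  \<open>F(z) = \<integral>max 0 (w - c) K(z, dw)\<close> is convex.

  \<^bold>\<open>An optimal stopping form of \<open>F\<close>.\<close> Write \<open>M\<close> for the updated mean. For a Borel set \<open>C\<close> the tower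
  property gives \<open>E\<^sub>z[(M - c) 1\<^sub>C(X)] = E\<^sub>z[(T - c) p]\<close> with \<open>p u = P\<^sub>u(X \<in> C)\<close>. Hence
  \<open>F(z) \<ge> E\<^sub>z[(T - c) p]\<close> for every \<open>C\<close>, with equality when \<open>C\<close> is the set where \<open>M > c\<close>. Since \<open>M\<close>
  is non-decreasing in the observation wherever it is defined, this \<open>C\<close> is an up-set up to a null
  set, and replacing it by an up-set makes \<open>p\<close> non-decreasing on
  \<open>S\<close> by the monotone likelihood ratio.

  \<^bold>\<open>The chord inequality\<close> (\<open>hinge_below_chord\<close>). Let \<open>z1 < z0 < z3\<close>, let \<open>p\<close> be optimal for \<open>z0\<close>, and
  suppose \<open>F(z0)\<close> lies above the chord \<open>L\<close> through \<open>(z1, F(z1))\<close> and \<open>(z3, F(z3))\<close>, with slope \<open>\<beta>\<close>.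
  Single-crossing arguments give \<open>F(z0) \<le> F(z3)\<close> and \<open>F(z0) - z0 \<le> F(z1) - z1\<close>, which force
  \<open>0 \<le> \<beta> \<le> 1\<close>; together with \<open>F(z1) \<ge> max 0 (z1 - c)\<close> this yields \<open>\<kappa> = L(c) \<ge> 0\<close>. Now
  \<open>(T - c) p - L(T) = (T - c) (p - \<beta>) - \<kappa>\<close>. A product of two non-decreasing functions stays below a
  nonnegative level on an interval only, so this function has the sign pattern \<open>+, -, +\<close>. Its means
  at \<open>z1\<close> and \<open>z3\<close> are at most \<open>0\<close> because \<open>F \<ge> E[(T - c) p]\<close>. Nonnegative coefficients can be chosen
  so that \<open>A exp (u * y1) + C exp (u * y3) - exp (u * y0)\<close> has the same sign pattern
  (\<open>exp_chord\<close>), and integrating the product of the two functions shows that the mean at \<open>z0\<close> is at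
  most \<open>0\<close> as well (\<open>exp_tilt_double_crossing\<close>). This says that \<open>F(z0)\<close> is at most \<open>L(z0)\<close>.
\<close>

section \<open>Sign changes under exponential tilting\<close>

lemma no_descent_crossing_point:
  fixes \<xi> :: "real \<Rightarrow> real" and S :: "real set"
  assumes no_descent: "\<And>u v. u \<in> S \<Longrightarrow> v \<in> S \<Longrightarrow> u < v \<Longrightarrow> 0 < \<xi> u \<Longrightarrow> 0 \<le> \<xi> v"
  shows "(\<forall>u\<in>S. \<xi> u \<le> 0) \<or> (\<forall>u\<in>S. 0 \<le> \<xi> u) \<or>
      (\<exists>b. \<forall>u\<in>S. (u < b \<longrightarrow> \<xi> u \<le> 0) \<and> (b < u \<longrightarrow> 0 \<le> \<xi> u))"
proof -
  define A where "A = {u \<in> S. 0 < \<xi> u}"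
  have after: "0 \<le> \<xi> u" if "u \<in> S" "a \<in> A" "a < u" for a u
    using no_descent[of a u] that by (auto simp: A_def)
  consider "A = {}" | "\<not> bdd_below A" | "A \<noteq> {}" "bdd_below A" by blast
  then show ?thesis
  proof cases
    case 1
    then have "\<forall>u\<in>S. \<xi> u \<le> 0" by (auto simp: A_def not_less)
    then show ?thesis by blast
  next
    case 2
    then have "\<exists>a\<in>A. a < u" for u unfolding bdd_below_def by (meson not_le)
    then have "\<forall>u\<in>S. 0 \<le> \<xi> u" using after by blast
    then show ?thesis by blast
  next
    case 3
    have "\<xi> u \<le> 0" if "u \<in> S" "u < Inf A" for u
      using 3 that cInf_lower[of u A] by (force simp: A_def)
    moreover have "0 \<le> \<xi> u" if u: "u \<in> S" "Inf A < u" for u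
    proof -
      obtain a where "a \<in> A" "a < u" using 3 u by (auto simp: cInf_less_iff)
      then show ?thesis using after u by blast
    qed
    ultimately show ?thesis by blast
  qed
qed

text \<open>The factor \<open>exp (u * y') - exp (b * (y' - y)) * exp (u * y)\<close> has the same sign as \<open>\<xi> u\<close>: it is at
  most zero for \<open>u < b\<close> and at least zero for \<open>u > b\<close>.\<close>

lemma exp_tilt_crossing_pointwise:
  fixes \<xi> :: "real \<Rightarrow> real"
  assumes "u < b \<Longrightarrow> \<xi> u \<le> 0" "b < u \<Longrightarrow> 0 \<le> \<xi> u" "y \<le> y'"
  shows "0 \<le> \<xi> u * exp (u * y') - exp (b * (y' - y)) * (\<xi> u * exp (u * y))"
proof -
  have *: "\<xi> u * exp (u * y') - exp (b * (y' - y)) * (\<xi> u * exp (u * y))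
      = \<xi> u * exp (u * y) * (exp (u * (y' - y)) - exp (b * (y' - y)))"
    by (simp add: algebra_simps flip: exp_add)
  consider "u < b" | "u = b" | "b < u" by linarith
  then show ?thesis
  proof cases
    case 1
    then have "exp (u * (y' - y)) \<le> exp (b * (y' - y))"
      using \<open>y \<le> y'\<close> by (simp add: mult_right_mono)
    then show ?thesis
      unfolding * using 1 assms by (simp add: mult_nonpos_nonpos mult_nonpos_nonneg)
  next
    case 3
    then have "exp (b * (y' - y)) \<le> exp (u * (y' - y))"
      using \<open>y \<le> y'\<close> by (simp add: mult_right_mono)
    then show ?thesis unfolding * using 3 assms by simp
  qed (unfold *, simp)
qed

text \<open>Variation diminishing property of the kernel \<open>exp (u * y)\<close> for one sign change: increasing \<open>y\<close>
  moves weight to the side where \<open>\<xi>\<close> is nonnegative.\<close>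

lemma exp_tilt_single_crossing:
  fixes m :: "real measure" and \<xi> :: "real \<Rightarrow> real" and S :: "real set"
  assumes S: "AE u in m. u \<in> S"
    and no_descent: "\<And>u v. u \<in> S \<Longrightarrow> v \<in> S \<Longrightarrow> u < v \<Longrightarrow> 0 < \<xi> u \<Longrightarrow> 0 \<le> \<xi> v"
    and "y \<le> y'"
    and int: "integrable m (\<lambda>u. \<xi> u * exp (u * y))" "integrable m (\<lambda>u. \<xi> u * exp (u * y'))"
    and pos: "0 < (\<integral>u. \<xi> u * exp (u * y) \<partial>m)"
  shows "0 \<le> (\<integral>u. \<xi> u * exp (u * y') \<partial>m)"
proof -
  have "(\<forall>u\<in>S. \<xi> u \<le> 0) \<or> (\<forall>u\<in>S. 0 \<le> \<xi> u) \<or>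
      (\<exists>b. \<forall>u\<in>S. (u < b \<longrightarrow> \<xi> u \<le> 0) \<and> (b < u \<longrightarrow> 0 \<le> \<xi> u))"
    by (rule no_descent_crossing_point) (rule no_descent)
  then consider (nonpos) "\<forall>u\<in>S. \<xi> u \<le> 0" | (nonneg) "\<forall>u\<in>S. 0 \<le> \<xi> u"
    | (cross) b where "\<forall>u\<in>S. (u < b \<longrightarrow> \<xi> u \<le> 0) \<and> (b < u \<longrightarrow> 0 \<le> \<xi> u)"
    by blast
  then show ?thesis
  proof cases
    case nonpos
    have "AE u in m. \<xi> u * exp (u * y) \<le> 0"
      using S by (rule eventually_mono) (simp add: nonpos mult_nonpos_nonneg)
    then have "(\<integral>u. \<xi> u * exp (u * y) \<partial>m) \<le> (\<integral>u. 0 \<partial>m)"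
      by (intro integral_mono_AE int) auto
    with pos show ?thesis by simp
  next
    case nonneg
    have "AE u in m. 0 \<le> \<xi> u * exp (u * y')"
      using S by (rule eventually_mono) (simp add: nonneg)
    then show ?thesis by (rule integral_nonneg_AE)
  next
    case (cross b)
    have "AE u in m. 0 \<le> \<xi> u * exp (u * y') - exp (b * (y' - y)) * (\<xi> u * exp (u * y))"
      using S by (rule eventually_mono) (rule exp_tilt_crossing_pointwise; use cross \<open>y \<le> y'\<close> in auto)
    then have "0 \<le> (\<integral>u. \<xi> u * exp (u * y') - exp (b * (y' - y)) * (\<xi> u * exp (u * y)) \<partial>m)"
      by (rule integral_nonneg_AE)
    also have "\<dots> = (\<integral>u. \<xi> u * exp (u * y') \<partial>m) - exp (b * (y' - y)) * (\<integral>u. \<xi> u * exp (u * y) \<partial>m)"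
      using int by simp
    finally show ?thesis
      using pos by (smt (verit) exp_gt_zero mult_pos_pos)
  qed
qed

text \<open>The equality case of the preceding comparison. If both tilts annihilate \<open>\<xi>\<close>, the nonnegative
  function of \<open>exp_tilt_crossing_pointwise\<close> vanishes almost everywhere, so \<open>\<xi>\<close> can only survive at
  the crossing point \<open>b\<close>; it then has constant sign and vanishes there too.\<close>

lemma exp_tilt_vanishing_imp_zero:
  fixes m :: "real measure" and \<xi> :: "real \<Rightarrow> real" and S :: "real set"
  assumes S: "AE u in m. u \<in> S"
    and no_descent: "\<And>u v. u \<in> S \<Longrightarrow> v \<in> S \<Longrightarrow> u < v \<Longrightarrow> 0 < \<xi> u \<Longrightarrow> 0 \<le> \<xi> v"
    and "y < y'"
    and int: "integrable m (\<lambda>u. \<xi> u * exp (u * y))" "integrable m (\<lambda>u. \<xi> u * exp (u * y'))"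
    and zero: "(\<integral>u. \<xi> u * exp (u * y) \<partial>m) = 0" "(\<integral>u. \<xi> u * exp (u * y') \<partial>m) = 0"
  shows "AE u in m. \<xi> u = 0"
proof -
  have sign: ?thesis if "(AE u in m. 0 \<le> \<xi> u) \<or> (AE u in m. \<xi> u \<le> 0)"
  proof -
    have "AE u in m. \<xi> u * exp (u * y) = 0"
      using that
    proof
      assume "AE u in m. 0 \<le> \<xi> u"
      then have "AE u in m. 0 \<le> \<xi> u * exp (u * y)" by eventually_elim simp
      then show ?thesis using integral_nonneg_eq_0_iff_AE[OF int(1)] zero by simp
    next
      assume "AE u in m. \<xi> u \<le> 0"
      then have "AE u in m. 0 \<le> - (\<xi> u * exp (u * y))"
        by eventually_elim (simp add: mult_nonpos_nonneg)
      then show ?thesis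
        using integral_nonneg_eq_0_iff_AE[of m "\<lambda>u. - (\<xi> u * exp (u * y))"] int zero by simp
    qed
    then show ?thesis by eventually_elim simp
  qed
  show ?thesis
  proof -
  have "(\<forall>u\<in>S. \<xi> u \<le> 0) \<or> (\<forall>u\<in>S. 0 \<le> \<xi> u) \<or>
      (\<exists>b. \<forall>u\<in>S. (u < b \<longrightarrow> \<xi> u \<le> 0) \<and> (b < u \<longrightarrow> 0 \<le> \<xi> u))"
    by (rule no_descent_crossing_point) (rule no_descent)
  then consider (nonpos) "\<forall>u\<in>S. \<xi> u \<le> 0" | (nonneg) "\<forall>u\<in>S. 0 \<le> \<xi> u"
    | (cross) b where "\<forall>u\<in>S. (u < b \<longrightarrow> \<xi> u \<le> 0) \<and> (b < u \<longrightarrow> 0 \<le> \<xi> u)"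
    by blast
  then show ?thesis
  proof cases
      case nonpos
      have "AE u in m. \<xi> u \<le> 0" using S by (rule eventually_mono) (simp add: nonpos)
      then show ?thesis using sign by blast
    next
      case nonneg
      have "AE u in m. 0 \<le> \<xi> u" using S by (rule eventually_mono) (simp add: nonneg)
      then show ?thesis using sign by blast
    next
      case (cross b)
      let ?f = "\<lambda>u. \<xi> u * exp (u * y') - exp (b * (y' - y)) * (\<xi> u * exp (u * y))"
      have "AE u in m. 0 \<le> ?f u"
        using S by (rule eventually_mono) (rule exp_tilt_crossing_pointwise; use cross \<open>y < y'\<close> in auto)
      moreover have "integrable m ?f" "(\<integral>u. ?f u \<partial>m) = 0" using int zero by simp_all
      ultimately have "AE u in m. ?f u = 0" using integral_nonneg_eq_0_iff_AE by blast
      moreover have "\<xi> u = 0 \<or> u = b" if "?f u = 0" for u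
      proof -
        have "?f u = \<xi> u * exp (u * y) * (exp (u * (y' - y)) - exp (b * (y' - y)))"
          by (simp add: algebra_simps flip: exp_add)
        with that \<open>y < y'\<close> show ?thesis by simp
      qed
      ultimately have only_b: "AE u in m. \<xi> u = 0 \<or> u = b"
        by (rule eventually_mono)
      show ?thesis
      proof (cases "0 \<le> \<xi> b")
        case True
        have "AE u in m. 0 \<le> \<xi> u" using only_b by (rule eventually_mono) (use True in auto)
        then show ?thesis using sign by blast
      next
        case False
        have "AE u in m. \<xi> u \<le> 0" using only_b by (rule eventually_mono) (use False in auto)
        then show ?thesis using sign by blast
      qed
    qed
  qed
qed

lemma convex_on_two_zeros:
  fixes g :: "real \<Rightarrow> real"
  assumes g: "convex_on UNIV g" and "a < b" "g a = 0" "g b = 0"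
  shows "a \<le> u \<Longrightarrow> u \<le> b \<Longrightarrow> g u \<le> 0" "u \<le> a \<or> b \<le> u \<Longrightarrow> 0 \<le> g u"
proof -
  show "g u \<le> 0" if "a \<le> u" "u \<le> b"
  proof -
    define s where "s = (u - a) / (b - a)"
    have "u = a + s * (b - a)" "0 \<le> s" "s \<le> 1"
      using that \<open>a < b\<close> unfolding s_def by auto
    then have "u = (1 - s) * a + s * b" by (simp add: algebra_simps)
    with \<open>0 \<le> s\<close> \<open>s \<le> 1\<close> show ?thesis using convex_onD[OF g, of s a b] assms by auto
  qed
  show "0 \<le> g u" if "u \<le> a \<or> b \<le> u"
  proof (rule ccontr)
    assume neg: "\<not> 0 \<le> g u"
    from that consider "u < a" | "b < u" | "u = a" | "u = b" by linarith
    then show False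
    proof cases
      case 1
      define s where "s = (a - u) / (b - u)"
      have s: "a = u + s * (b - u)" "0 \<le> s" "s < 1"
        using 1 \<open>a < b\<close> unfolding s_def by auto
      moreover have "u + s * (b - u) = (1 - s) * u + s * b" by (simp add: algebra_simps)
      ultimately have "g a \<le> (1 - s) * g u" using convex_onD[OF g, of s u b] assms by auto
      moreover have "(1 - s) * g u < 0" using neg \<open>s < 1\<close> by (simp add: mult_pos_neg)
      ultimately show False using assms by simp
    next
      case 2
      define s where "s = (b - a) / (u - a)"
      have s: "b = a + s * (u - a)" "0 < s" "s \<le> 1"
        using 2 \<open>a < b\<close> unfolding s_def by auto
      moreover have "a + s * (u - a) = (1 - s) * a + s * u" by (simp add: algebra_simps)
      ultimately have "g b \<le> s * g u" using convex_onD[OF g, of s a u] assms by auto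
      moreover have "s * g u < 0" using neg \<open>0 < s\<close> by (simp add: mult_pos_neg)
      ultimately show False using assms by simp
    qed (use neg assms in auto)
  qed
qed

lemma convex_on_exp_line: "convex_on UNIV (\<lambda>u::real. exp (u * c))"
proof (rule f''_ge0_imp_convex)
  show "((\<lambda>u. exp (u * c)) has_real_derivative c * exp (u * c)) (at u)" for u
    by (auto intro!: derivative_eq_intros)
  show "((\<lambda>u. c * exp (u * c)) has_real_derivative c * c * exp (u * c)) (at u)" for u
    by (auto intro!: derivative_eq_intros)
qed auto

text \<open>The convex function \<open>A exp (- p u) + C exp (q u) - 1\<close> can be given its two zeros at prescribed
  points \<open>a < b\<close>, or a double zero at \<open>a = b\<close>.\<close>

lemma exp_chord:
  fixes a b p q :: real
  assumes "a \<le> b" "0 < p" "0 < q"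
  obtains A C where "0 \<le> A" "0 \<le> C"
    "\<And>u. a \<le> u \<Longrightarrow> u \<le> b \<Longrightarrow> A * exp (u * - p) + C * exp (u * q) \<le> 1"
    "\<And>u. u \<le> a \<or> b \<le> u \<Longrightarrow> 1 \<le> A * exp (u * - p) + C * exp (u * q)"
proof (cases "a = b")
  case True
  \<comment> \<open>Weights that cancel the linear terms of the two exponentials at \<open>a\<close>.\<close>
  define A where "A = q / (p + q) * exp (a * p)"
  define C where "C = p / (p + q) * exp (- a * q)"
  have *: "A * exp (u * - p) + C * exp (u * q)
      = q / (p + q) * exp ((u - a) * - p) + p / (p + q) * exp ((u - a) * q)" for u
    unfolding A_def C_def by (simp add: algebra_simps flip: exp_add)
  have ge: "1 \<le> A * exp (u * - p) + C * exp (u * q)" for u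
  proof -
    have "1 = q / (p + q) * (1 + (u - a) * - p) + p / (p + q) * (1 + (u - a) * q)"
    proof -
      have "q / (p + q) + p / (p + q) = 1" "q / (p + q) * p = p / (p + q) * q"
        using assms by (simp_all add: add.commute flip: add_divide_distrib)
      then show ?thesis by algebra
    qed
    also have "\<dots> \<le> A * exp (u * - p) + C * exp (u * q)"
      unfolding * using assms by (intro add_mono mult_left_mono exp_ge_add_one_self) auto
    finally show ?thesis .
  qed
  show thesis
  proof (rule that[of A C])
    show "A * exp (u * - p) + C * exp (u * q) \<le> 1" if "a \<le> u" "u \<le> b" for u
    proof -
      have "u = a" using that True by simp
      then show ?thesis unfolding * using assms by (simp add: field_simps)
    qed
  qed (use assms ge in \<open>auto simp: A_def C_def\<close>)
next
  case False
  then have "a < b" using assms by simp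
  define d where "d = b - a"
  have "d > 0" using \<open>a < b\<close> by (simp add: d_def)
  \<comment> \<open>After a shift by \<open>a\<close>, the zero at \<open>0\<close> forces weights adding up to one, and the zero at \<open>d\<close>
    determines the second one.\<close>
  define D where "D = exp (d * q) - exp (d * - p)"
  define C' where "C' = (1 - exp (d * - p)) / D"
  have less: "exp (d * - p) < 1" "1 < exp (d * q)"
    using assms \<open>d > 0\<close> by (auto simp: mult_neg_pos)
  then have "D > 0" by (simp add: D_def)
  then have C': "0 \<le> C'" "C' \<le> 1" using less by (auto simp: C'_def D_def)
  define A where "A = (1 - C') * exp (a * p)"
  define C where "C = C' * exp (- a * q)"
  define g where "g u = A * exp (u * - p) + C * exp (u * q) - 1" for u
  have AC: "0 \<le> A" "0 \<le> C" using C' by (auto simp: A_def C_def)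
  have g_eq: "g u = (1 - C') * exp ((u - a) * - p) + C' * exp ((u - a) * q) - 1" for u
    unfolding g_def A_def C_def by (simp add: algebra_simps flip: exp_add)
  have "convex_on UNIV g"
    unfolding g_def using AC
    by (intro convex_on_diff convex_on_add convex_on_cmul convex_on_exp_line) (auto simp: concave_on_const)
  moreover have "g a = 0" by (simp add: g_eq)
  moreover have "g b = exp (d * - p) - 1 + C' * D"
    by (simp add: g_eq D_def d_def algebra_simps)
  then have "g b = 0" using \<open>D > 0\<close> by (simp add: C'_def)
  ultimately have "a \<le> u \<Longrightarrow> u \<le> b \<Longrightarrow> g u \<le> 0" "u \<le> a \<or> b \<le> u \<Longrightarrow> 0 \<le> g u" for u
    using convex_on_two_zeros[of g a b] \<open>a < b\<close> by blast+
  then show thesis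
    by (intro that[of A C] AC) (force simp: g_def)+
qed

text \<open>Variation diminishing property for two sign changes. The coefficients from \<open>exp_chord\<close>, with the
  zeros at the ends of the set where \<open>\<xi>\<close> is nonpositive, make
  \<open>\<xi> u * (A exp (u * y1) + C exp (u * y3) - exp (u * y0))\<close> nonnegative on \<open>S\<close>. When that set is
  unbounded on one side, one of the two exponentials alone suffices.\<close>

lemma exp_tilt_double_crossing:
  fixes m :: "real measure" and \<xi> :: "real \<Rightarrow> real" and S :: "real set"
  assumes S: "AE u in m. u \<in> S"
    and conv: "\<And>u v w. u \<in> S \<Longrightarrow> v \<in> S \<Longrightarrow> w \<in> S \<Longrightarrow> u < v \<Longrightarrow> v < w \<Longrightarrow>
      \<xi> u \<le> 0 \<Longrightarrow> \<xi> w \<le> 0 \<Longrightarrow> \<xi> v \<le> 0"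
    and y: "y1 < y0" "y0 < y3"
    and int: "integrable m (\<lambda>u. \<xi> u * exp (u * y1))" "integrable m (\<lambda>u. \<xi> u * exp (u * y0))"
      "integrable m (\<lambda>u. \<xi> u * exp (u * y3))"
    and le: "(\<integral>u. \<xi> u * exp (u * y1) \<partial>m) \<le> 0" "(\<integral>u. \<xi> u * exp (u * y3) \<partial>m) \<le> 0"
  shows "(\<integral>u. \<xi> u * exp (u * y0) \<partial>m) \<le> 0"
proof -
  define D where "D = {u \<in> S. \<xi> u \<le> 0}"
  define p where "p = y0 - y1"
  define q where "q = y3 - y0"
  have pq: "0 < p" "0 < q" using y by (auto simp: p_def q_def)
  \<comment> \<open>All but two of the cases below reduce to finding the two coefficients.\<close>
  have by_comparison: ?thesis if AC: "0 \<le> A" "0 \<le> C"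
    and D_le: "\<And>u. u \<in> D \<Longrightarrow> A * exp (u * - p) + C * exp (u * q) \<le> 1"
    and nD_ge: "\<And>u. u \<in> S - D \<Longrightarrow> 1 \<le> A * exp (u * - p) + C * exp (u * q)" for A C
  proof -
    have "AE u in m. \<xi> u * exp (u * y0) \<le> A * (\<xi> u * exp (u * y1)) + C * (\<xi> u * exp (u * y3))"
      using S
    proof eventually_elim
      case (elim u)
      have eq: "A * (\<xi> u * exp (u * y1)) + C * (\<xi> u * exp (u * y3)) - \<xi> u * exp (u * y0)
          = exp (u * y0) * (\<xi> u * (A * exp (u * - p) + C * exp (u * q) - 1))"
        by (simp add: p_def q_def algebra_simps flip: exp_add)
      have "0 \<le> \<xi> u * (A * exp (u * - p) + C * exp (u * q) - 1)"
      proof (cases "u \<in> D")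
        case True
        then show ?thesis using D_le[OF True] by (intro mult_nonpos_nonpos) (auto simp: D_def)
      next
        case False
        then show ?thesis using nD_ge[of u] elim by (intro mult_nonneg_nonneg) (auto simp: D_def)
      qed
      then have "0 \<le> exp (u * y0) * (\<xi> u * (A * exp (u * - p) + C * exp (u * q) - 1))" by simp
      then show ?case using eq by linarith
    qed
    then have "(\<integral>u. \<xi> u * exp (u * y0) \<partial>m)
        \<le> (\<integral>u. A * (\<xi> u * exp (u * y1)) + C * (\<xi> u * exp (u * y3)) \<partial>m)"
      using int by (intro integral_mono_AE) auto
    also have "\<dots> = A * (\<integral>u. \<xi> u * exp (u * y1) \<partial>m) + C * (\<integral>u. \<xi> u * exp (u * y3) \<partial>m)"
      using int by simp
    also have "\<dots> \<le> 0"
      using AC le by (simp add: add_nonpos_nonpos mult_nonneg_nonpos)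
    finally show ?thesis .
  qed
  consider "D = {}" | "D \<noteq> {}" "bdd_below D" "bdd_above D" | "D \<noteq> {}" "bdd_below D" "\<not> bdd_above D"
    | "\<not> bdd_below D" "bdd_above D" "D \<noteq> {}" | "\<not> bdd_below D" "\<not> bdd_above D" by argo
  then show ?thesis
  proof cases
    case 1
    have AE1: "AE u in m. 0 \<le> \<xi> u * exp (u * y1)"
      using S by (rule eventually_mono) (use 1 in \<open>auto simp: D_def not_le less_imp_le\<close>)
    then have "(\<integral>u. \<xi> u * exp (u * y1) \<partial>m) = 0"
      using le(1) integral_nonneg_AE[OF AE1] by linarith
    then have "AE u in m. \<xi> u * exp (u * y1) = 0"
      using integral_nonneg_eq_0_iff_AE[OF int(1) AE1] by simp
    then have "AE u in m. \<xi> u * exp (u * y0) = 0" by eventually_elim auto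
    then show ?thesis by (simp add: integral_eq_zero_AE)
  next
    case 2
    define a where "a = Inf D"
    define b where "b = Sup D"
    have ab: "a \<le> u" "u \<le> b" if "u \<in> D" for u
      using 2 that by (auto simp: a_def b_def cInf_lower cSup_upper)
    then have "a \<le> b" using 2 by (meson equals0I order_trans)
    then obtain A C where AC: "0 \<le> A" "0 \<le> C"
      and in_ab: "\<And>u. a \<le> u \<Longrightarrow> u \<le> b \<Longrightarrow> A * exp (u * - p) + C * exp (u * q) \<le> 1"
      and out_ab: "\<And>u. u \<le> a \<or> b \<le> u \<Longrightarrow> 1 \<le> A * exp (u * - p) + C * exp (u * q)"
      using exp_chord[OF _ pq] by metis
    have "u \<le> a \<or> b \<le> u" if "u \<in> S - D" for u
    proof (rule ccontr)
      assume "\<not> (u \<le> a \<or> b \<le> u)"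
      then obtain v w where "v \<in> D" "v < u" "w \<in> D" "u < w"
        using 2 by (metis a_def b_def cInf_less_iff less_cSup_iff not_le)
      then show False using conv[of v u w] that by (auto simp: D_def)
    qed
    then show ?thesis using by_comparison[OF AC in_ab out_ab] ab by auto
  next
    case 3
    define a where "a = Inf D"
    have "u \<le> a" if "u \<in> S - D" for u
    proof (rule ccontr)
      assume "\<not> u \<le> a"
      then obtain v w where "v \<in> D" "v < u" "w \<in> D" "u < w"
        using 3 by (metis a_def bdd_above_def cInf_less_iff not_le)
      then show False using conv[of v u w] that by (auto simp: D_def)
    qed
    moreover have "a \<le> u" if "u \<in> D" for u
      using 3 that by (auto simp: a_def cInf_lower)
    moreover have "exp (a * p) * exp (u * - p) = exp ((a - u) * p)" for u
      by (simp add: algebra_simps flip: exp_add)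
    ultimately show ?thesis using by_comparison[of "exp (a * p)" 0] pq
      by (simp add: mult_le_0_iff zero_le_mult_iff)
  next
    case 4
    define b where "b = Sup D"
    have "b \<le> u" if "u \<in> S - D" for u
    proof (rule ccontr)
      assume "\<not> b \<le> u"
      then obtain v w where "v \<in> D" "v < u" "w \<in> D" "u < w"
        using 4 by (metis b_def bdd_below_def less_cSup_iff not_le)
      then show False using conv[of v u w] that by (auto simp: D_def)
    qed
    moreover have "u \<le> b" if "u \<in> D" for u
      using 4 that by (auto simp: b_def cSup_upper)
    moreover have "exp (- b * q) * exp (u * q) = exp ((u - b) * q)" for u
      by (simp add: algebra_simps flip: exp_add)
    ultimately show ?thesis using by_comparison[of 0 "exp (- b * q)"] pq
      by (simp add: mult_le_0_iff zero_le_mult_iff)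
  next
    case 5
    have nonpos: "\<xi> u \<le> 0" if "u \<in> S" for u
    proof -
      obtain v w where "v \<in> D" "v < u" "w \<in> D" "u < w"
        using 5 by (meson bdd_above_def bdd_below_def not_le)
      then show ?thesis using conv[of v u w] that by (auto simp: D_def)
    qed
    have "AE u in m. \<xi> u * exp (u * y0) \<le> 0"
      using S by (rule eventually_mono) (simp add: nonpos mult_nonpos_nonneg)
    then have "(\<integral>u. \<xi> u * exp (u * y0) \<partial>m) \<le> (\<integral>u. 0 \<partial>m)"
      by (intro integral_mono_AE int) auto
    then show ?thesis by simp
  qed
qed

text \<open>Where both factors are nonnegative the product increases, where both are nonpositive it decreases,
  and elsewhere it is nonpositive. The level has to be nonnegative, because in the last region the
  product may oscillate.\<close>

lemma mult_mono_on_quasiconvex: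
  fixes a b :: "real \<Rightarrow> real"
  assumes "mono_on S a" "mono_on S b" "u \<in> S" "v \<in> S" "w \<in> S" "u < v" "v < w"
    and "a u * b u \<le> \<kappa>" "a w * b w \<le> \<kappa>" "0 \<le> \<kappa>"
  shows "a v * b v \<le> \<kappa>"
proof -
  have m: "a u \<le> a v" "a v \<le> a w" "b u \<le> b v" "b v \<le> b w"
    using assms by (auto intro: mono_onD)
  consider "0 \<le> a v" "0 \<le> b v" | "a v \<le> 0" "b v \<le> 0" | "a v * b v \<le> 0"
    by (meson linorder_le_cases mult_nonneg_nonpos mult_nonpos_nonneg)
  then show ?thesis
  proof cases
    case 1
    then have "a v * b v \<le> a w * b w" using m by (intro mult_mono) auto
    then show ?thesis using assms by linarith
  next
    case 2
    then have "a v * b v \<le> a u * b u" using m mult_mono[of "- a v" "- a u" "- b v" "- b u"] by auto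
    then show ?thesis using assms by linarith
  qed (use assms in linarith)
qed

definition tilt_mean :: "real measure \<Rightarrow> real \<Rightarrow> (real \<Rightarrow> real) \<Rightarrow> real" where
  "tilt_mean m y g = (\<integral>u. g u * exp (u * y) \<partial>m) / (\<integral>u. exp (u * y) \<partial>m)"

lemma tilt_mean_affine:
  assumes int: "integrable m (\<lambda>u. exp (u * y))" "integrable m (\<lambda>u. g u * exp (u * y))"
      "integrable m (\<lambda>u. h u * exp (u * y))"
    and pos: "0 < (\<integral>u. exp (u * y) \<partial>m)"
  shows "tilt_mean m y (\<lambda>u. a * g u + b * h u + c) = a * tilt_mean m y g + b * tilt_mean m y h + c"
    and "integrable m (\<lambda>u. (a * g u + b * h u + c) * exp (u * y))"
proof -
  have *: "(a * g u + b * h u + c) * exp (u * y)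
      = a * (g u * exp (u * y)) + b * (h u * exp (u * y)) + c * exp (u * y)" for u
    by (simp add: algebra_simps)
  show "integrable m (\<lambda>u. (a * g u + b * h u + c) * exp (u * y))"
    unfolding * using int by simp
  show "tilt_mean m y (\<lambda>u. a * g u + b * h u + c) = a * tilt_mean m y g + b * tilt_mean m y h + c"
    unfolding tilt_mean_def * using int pos by (simp add: add_divide_distrib)
qed

lemma tilt_mean_single_crossing:
  assumes "AE u in m. u \<in> S"
    and "\<And>u v. u \<in> S \<Longrightarrow> v \<in> S \<Longrightarrow> u < v \<Longrightarrow> 0 < \<xi> u \<Longrightarrow> 0 \<le> \<xi> v"
    and "y \<le> y'"
    and "integrable m (\<lambda>u. \<xi> u * exp (u * y))" "integrable m (\<lambda>u. \<xi> u * exp (u * y'))"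
    and "0 < tilt_mean m y \<xi>"
  shows "0 \<le> tilt_mean m y' \<xi>"
proof -
  have "0 \<le> (\<integral>u. exp (u * y) \<partial>m)" by simp
  then have "0 < (\<integral>u. \<xi> u * exp (u * y) \<partial>m)"
    using assms(6) unfolding tilt_mean_def zero_less_divide_iff by linarith
  then show ?thesis
    using exp_tilt_single_crossing[OF assms(1-5)] by (simp add: tilt_mean_def)
qed

lemma tilt_mean_mono:
  assumes S: "AE u in m. u \<in> S" and T: "mono_on S T" and "y \<le> y'"
    and int: "\<And>x. x \<in> {y, y'} \<Longrightarrow> integrable m (\<lambda>u. exp (u * x))"
      "\<And>x. x \<in> {y, y'} \<Longrightarrow> integrable m (\<lambda>u. T u * exp (u * x))"
    and pos: "\<And>x. x \<in> {y, y'} \<Longrightarrow> 0 < (\<integral>u. exp (u * x) \<partial>m)"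
  shows "tilt_mean m y T \<le> tilt_mean m y' T"
proof (rule ccontr)
  assume "\<not> ?thesis"
  then obtain c where c: "tilt_mean m y' T < c" "c < tilt_mean m y T"
    using dense by (auto simp: not_le)
  have eq: "tilt_mean m x (\<lambda>u. T u - c) = tilt_mean m x T - c"
    and int': "integrable m (\<lambda>u. (T u - c) * exp (u * x))" if "x \<in> {y, y'}" for x
    using tilt_mean_affine[OF int(1)[OF that] int(2)[OF that] int(2)[OF that] pos[OF that], of 1 0 "- c"]
    by simp_all
  have "0 \<le> tilt_mean m y' (\<lambda>u. T u - c)"
  proof (rule tilt_mean_single_crossing[OF S _ \<open>y \<le> y'\<close>])
    show "0 \<le> T v - c" if "u \<in> S" "v \<in> S" "u < v" "0 < T u - c" for u v
      using mono_onD[OF T, of u v] that by simp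
    show "0 < tilt_mean m y (\<lambda>u. T u - c)" using eq[of y] c by simp
  qed (use int' in auto)
  then show False using eq[of y'] c by simp
qed

text \<open>Makes the tilted mean of \<open>T\<close> a legitimate coordinate in place of \<open>y\<close>.\<close>

lemma tilt_mean_eq_imp_AE_const:
  assumes S: "AE u in m. u \<in> S" and T: "mono_on S T" and "y < y'"
    and int: "\<And>x. x \<in> {y, y'} \<Longrightarrow> integrable m (\<lambda>u. exp (u * x))"
      "\<And>x. x \<in> {y, y'} \<Longrightarrow> integrable m (\<lambda>u. T u * exp (u * x))"
    and pos: "\<And>x. x \<in> {y, y'} \<Longrightarrow> 0 < (\<integral>u. exp (u * x) \<partial>m)"
    and eq: "tilt_mean m y T = tilt_mean m y' T"
  shows "AE u in m. T u = tilt_mean m y T"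
proof -
  define c where "c = tilt_mean m y T"
  have zero: "(\<integral>u. (T u - c) * exp (u * x) \<partial>m) = 0"
    and int': "integrable m (\<lambda>u. (T u - c) * exp (u * x))" if "x \<in> {y, y'}" for x
    using tilt_mean_affine[OF int(1)[OF that] int(2)[OF that] int(2)[OF that] pos[OF that], of 1 0 "- c"]
      that eq pos[OF that] by (auto simp: tilt_mean_def c_def)
  have "AE u in m. T u - c = 0"
  proof (rule exp_tilt_vanishing_imp_zero[OF S _ \<open>y < y'\<close>])
    show "0 \<le> T v - c" if "u \<in> S" "v \<in> S" "u < v" "0 < T u - c" for u v
      using mono_onD[OF T, of u v] that by simp
  qed (use zero int' in auto)
  then show ?thesis by (simp add: c_def)
qed

lemma tilt_mean_double_crossing:
  assumes "AE u in m. u \<in> S"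
    and "\<And>u v w. u \<in> S \<Longrightarrow> v \<in> S \<Longrightarrow> w \<in> S \<Longrightarrow> u < v \<Longrightarrow> v < w \<Longrightarrow>
      \<xi> u \<le> 0 \<Longrightarrow> \<xi> w \<le> 0 \<Longrightarrow> \<xi> v \<le> 0"
    and "y1 < y0" "y0 < y3"
    and "integrable m (\<lambda>u. \<xi> u * exp (u * y1))" "integrable m (\<lambda>u. \<xi> u * exp (u * y0))"
      "integrable m (\<lambda>u. \<xi> u * exp (u * y3))"
    and pos: "\<And>x. x \<in> {y1, y3} \<Longrightarrow> 0 < (\<integral>u. exp (u * x) \<partial>m)"
    and le: "tilt_mean m y1 \<xi> \<le> 0" "tilt_mean m y3 \<xi> \<le> 0"
  shows "tilt_mean m y0 \<xi> \<le> 0"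
proof -
  have "(\<integral>u. \<xi> u * exp (u * y1) \<partial>m) \<le> 0" "(\<integral>u. \<xi> u * exp (u * y3) \<partial>m) \<le> 0"
    using le pos[of y1] pos[of y3] by (simp_all add: tilt_mean_def divide_le_0_iff)
  from exp_tilt_double_crossing[OF assms(1-7) this] show ?thesis
    by (simp add: tilt_mean_def divide_nonpos_nonneg)
qed

text \<open>The heart of the proof. Here \<open>F\<close> stands for the expected hinge as a function of \<open>y\<close> and \<open>p\<close> for the
  probability, given the parameter, that the observation falls into the set that is optimal at \<open>y0\<close>.
  The weight \<open>s\<close> refers to the means \<open>\<Lambda>\<close>, not to the \<open>y\<close>, which is why convexity holds in \<open>z\<close>.\<close>

lemma hinge_below_chord:
  fixes m :: "real measure" and T p :: "real \<Rightarrow> real" and S :: "real set" and c :: real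
  defines "\<Lambda> y \<equiv> tilt_mean m y T"
  defines "H y \<equiv> tilt_mean m y (\<lambda>u. (T u - c) * p u)"
  assumes S: "AE u in m. u \<in> S" and T: "mono_on S T" and p: "mono_on S p"
    and p01: "\<And>u. u \<in> S \<Longrightarrow> 0 \<le> p u" "\<And>u. u \<in> S \<Longrightarrow> p u \<le> 1"
    and y: "y1 < y0" "y0 < y3"
    and int: "\<And>y. y \<in> {y1, y0, y3} \<Longrightarrow> integrable m (\<lambda>u. exp (u * y))"
      "\<And>y. y \<in> {y1, y0, y3} \<Longrightarrow> integrable m (\<lambda>u. T u * exp (u * y))"
      "\<And>y. y \<in> {y1, y0, y3} \<Longrightarrow> integrable m (\<lambda>u. (T u - c) * p u * exp (u * y))"
    and pos: "\<And>y. y \<in> {y1, y0, y3} \<Longrightarrow> 0 < (\<integral>u. exp (u * y) \<partial>m)"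
    and s: "0 < s" "s < 1" "\<Lambda> y0 = (1 - s) * \<Lambda> y1 + s * \<Lambda> y3" and less: "\<Lambda> y1 < \<Lambda> y3"
    and F: "\<And>y. y \<in> {y1, y0, y3} \<Longrightarrow> 0 \<le> F y" "\<And>y. y \<in> {y1, y0, y3} \<Longrightarrow> \<Lambda> y - c \<le> F y"
      "\<And>y. y \<in> {y1, y0, y3} \<Longrightarrow> H y \<le> F y"
    and F0: "F y0 = H y0"
  shows "F y0 \<le> (1 - s) * F y1 + s * F y3"
proof (rule ccontr)
  assume contr: "\<not> F y0 \<le> (1 - s) * F y1 + s * F y3"
  have lin: "tilt_mean m y (\<lambda>u. a * ((T u - c) * p u) + b * T u + d) = a * H y + b * \<Lambda> y + d"
    and lin_int: "integrable m (\<lambda>u. (a * ((T u - c) * p u) + b * T u + d) * exp (u * y))"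
    if "y \<in> {y1, y0, y3}" for y a b d
    unfolding H_def \<Lambda>_def
by (rule tilt_mean_affine[OF int(1)[OF that] int(3)[OF that] int(2)[OF that] pos[OF that]])+

  \<comment> \<open>The intermediate level \<open>d\<close> is nonnegative, so \<open>(T - c) p - d\<close> changes sign once, upwards.\<close>
  have "F y0 \<le> F y3"
  proof (rule ccontr)
    assume "\<not> F y0 \<le> F y3"
    then obtain d where d: "F y3 < d" "d < F y0" using dense by (auto simp: not_le)
    have "0 \<le> F y3" using F by simp
    with d have "0 \<le> d" by simp
    define \<xi> where "\<xi> u = 1 * ((T u - c) * p u) + 0 * T u + - d" for u
    have "0 \<le> tilt_mean m y3 \<xi>"
    proof (rule tilt_mean_single_crossing[OF S])
      show "0 \<le> \<xi> v" if "u \<in> S" "v \<in> S" "u < v" "0 < \<xi> u" for u v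
      proof -
        have "T u \<le> T v" "p u \<le> p v" using that mono_onD[OF T] mono_onD[OF p] by auto
        have "0 < (T u - c) * p u" using \<open>0 < \<xi> u\<close> \<open>0 \<le> d\<close> by (simp add: \<xi>_def)
        then have "0 \<le> T u - c" using p01[OF \<open>u \<in> S\<close>] by (simp add: zero_less_mult_iff)
        with \<open>T u \<le> T v\<close> \<open>p u \<le> p v\<close> have "(T u - c) * p u \<le> (T v - c) * p v"
          using p01[OF \<open>u \<in> S\<close>] by (intro mult_mono) auto
        with \<open>0 < \<xi> u\<close> show ?thesis by (simp add: \<xi>_def)
      qed
      show "0 < tilt_mean m y0 \<xi>" unfolding \<xi>_def using lin[of y0 1 0 "- d"] F0 d by simp
      show "integrable m (\<lambda>u. \<xi> u * exp (u * y0))" "integrable m (\<lambda>u. \<xi> u * exp (u * y3))"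
        unfolding \<xi>_def by (rule lin_int; simp)+
    qed (use y in auto)
    then have "d \<le> H y3" unfolding \<xi>_def using lin[of y3 1 0 "- d"] by simp
    then show False using F(3)[of y3] d by simp
  qed

  \<comment> \<open>The mirror image, with the hinge \<open>max 0 (c - w)\<close> and the complementary probability \<open>1 - p\<close>.\<close>
  moreover have "F y0 - \<Lambda> y0 \<le> F y1 - \<Lambda> y1"
  proof (rule ccontr)
    assume "\<not> F y0 - \<Lambda> y0 \<le> F y1 - \<Lambda> y1"
    then obtain d' where d': "F y1 - \<Lambda> y1 < d'" "d' < F y0 - \<Lambda> y0" using dense by (auto simp: not_le)
    define d where "d = d' + c"
    have "0 \<le> F y1 - (\<Lambda> y1 - c)" using F(2)[of y1] by simp
    with d' have "0 \<le> d" by (simp add: d_def)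
    define \<xi> where "\<xi> u = - 1 * ((T u - c) * p u) + 1 * T u + (d - c)" for u
    have \<xi>_eq: "\<xi> u = d - (c - T u) * (1 - p u)" for u by (simp add: \<xi>_def algebra_simps)
    have "0 \<le> tilt_mean m y0 \<xi>" if "0 < tilt_mean m y1 \<xi>"
    proof (rule tilt_mean_single_crossing[OF S _ _ _ _ that])
      show "0 \<le> \<xi> v" if "u \<in> S" "v \<in> S" "u < v" "0 < \<xi> u" for u v
      proof -
        have "T u \<le> T v" "p u \<le> p v" using that mono_onD[OF T] mono_onD[OF p] by auto
        have "(c - T v) * (1 - p v) \<le> d"
        proof (cases "c \<le> T v")
          case True
          then have "(c - T v) * (1 - p v) \<le> 0"
            using p01[OF \<open>v \<in> S\<close>] by (intro mult_nonpos_nonneg) auto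
          then show ?thesis using \<open>0 \<le> d\<close> by simp
        next
          case False
          then have "(c - T v) * (1 - p v) \<le> (c - T u) * (1 - p u)"
            using \<open>T u \<le> T v\<close> \<open>p u \<le> p v\<close> p01[OF \<open>v \<in> S\<close>] by (intro mult_mono) auto
          then show ?thesis using \<open>0 < \<xi> u\<close> by (simp add: \<xi>_eq)
        qed
        then show ?thesis by (simp add: \<xi>_eq)
      qed
      show "integrable m (\<lambda>u. \<xi> u * exp (u * y1))" "integrable m (\<lambda>u. \<xi> u * exp (u * y0))"
        unfolding \<xi>_def by (rule lin_int; simp)+
    qed (use y in auto)
    moreover have "tilt_mean m y0 \<xi> = \<Lambda> y0 - H y0 + (d - c)" "tilt_mean m y1 \<xi> = \<Lambda> y1 - H y1 + (d - c)"
      unfolding \<xi>_def using lin[of y0 "- 1" 1 "d - c"] lin[of y1 "- 1" 1 "d - c"] by simp_all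
    ultimately show False using F(3)[of y1] F0 d' by (auto simp: d_def)
  qed

  ultimately have "(1 - s) * (F y3 - F y1) > 0" "s * ((\<Lambda> y3 - \<Lambda> y1) - (F y3 - F y1)) > 0"
    using contr s(3) by (auto simp: algebra_simps)
  then have slope: "0 < F y3 - F y1" "F y3 - F y1 < \<Lambda> y3 - \<Lambda> y1"
    using s by (simp_all add: zero_less_mult_iff)

  define \<beta> where "\<beta> = (F y3 - F y1) / (\<Lambda> y3 - \<Lambda> y1)"
  have \<beta>: "0 \<le> \<beta>" "\<beta> \<le> 1" using slope less by (auto simp: \<beta>_def)
  have F3: "F y3 = F y1 + \<beta> * (\<Lambda> y3 - \<Lambda> y1)" using less by (simp add: \<beta>_def)
  define \<kappa> where "\<kappa> = F y1 + \<beta> * (c - \<Lambda> y1)"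
  \<comment> \<open>\<open>\<kappa>\<close> is the value of the chord at \<open>c\<close>, also when \<open>c\<close> lies outside the interval between the means.\<close>
  have "0 \<le> \<kappa>"
  proof (cases "c \<le> \<Lambda> y1")
    case True
    have "\<kappa> = (F y1 - (\<Lambda> y1 - c)) + (1 - \<beta>) * (\<Lambda> y1 - c)" by (simp add: \<kappa>_def algebra_simps)
    also have "0 \<le> \<dots>" using F(2)[of y1] \<beta> True by (intro add_nonneg_nonneg mult_nonneg_nonneg) auto
    finally show ?thesis .
  next
    case False
    then show ?thesis using F(1)[of y1] \<beta> by (simp add: \<kappa>_def)
  qed
  define \<xi> where "\<xi> u = 1 * ((T u - c) * p u) + - \<beta> * T u + (\<beta> * c - \<kappa>)" for u
  have \<xi>_eq: "\<xi> u = (T u - c) * (p u - \<beta>) - \<kappa>" for u by (simp add: \<xi>_def algebra_simps)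
  have \<xi>_mean: "tilt_mean m y \<xi> = H y - \<beta> * \<Lambda> y + (\<beta> * c - \<kappa>)" if "y \<in> {y1, y0, y3}" for y
    unfolding \<xi>_def using lin[OF that, of 1 "- \<beta>" "\<beta> * c - \<kappa>"] by simp
  have "tilt_mean m y0 \<xi> \<le> 0"
  proof (rule tilt_mean_double_crossing[OF S _ y])
    show "\<xi> v \<le> 0" if "u \<in> S" "v \<in> S" "w \<in> S" "u < v" "v < w" "\<xi> u \<le> 0" "\<xi> w \<le> 0" for u v w
    proof -
      have "mono_on S (\<lambda>u. T u - c)" "mono_on S (\<lambda>u. p u - \<beta>)"
        using T p by (auto simp: mono_on_def)
      from mult_mono_on_quasiconvex[OF this, of u v w \<kappa>] show ?thesis
        using that \<open>0 \<le> \<kappa>\<close> by (simp add: \<xi>_eq)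
    qed
    show "integrable m (\<lambda>u. \<xi> u * exp (u * y1))" "integrable m (\<lambda>u. \<xi> u * exp (u * y0))"
      "integrable m (\<lambda>u. \<xi> u * exp (u * y3))"
      unfolding \<xi>_def by (rule lin_int; simp)+
    show "tilt_mean m y1 \<xi> \<le> 0"
      using \<xi>_mean[of y1] F(3)[of y1] by (simp add: \<kappa>_def algebra_simps)
    show "tilt_mean m y3 \<xi> \<le> 0"
      using \<xi>_mean[of y3] F(3)[of y3] F3 by (simp add: \<kappa>_def algebra_simps)
  qed (use pos in auto)
  then have "F y0 \<le> F y1 + \<beta> * (\<Lambda> y0 - \<Lambda> y1)"
    using \<xi>_mean[of y0] F0 by (simp add: \<kappa>_def algebra_simps)
  also have "\<Lambda> y0 - \<Lambda> y1 = s * (\<Lambda> y3 - \<Lambda> y1)" using s(3) by (simp add: algebra_simps)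
  also have "F y1 + \<beta> * (s * (\<Lambda> y3 - \<Lambda> y1)) = (1 - s) * F y1 + s * F y3"
    unfolding F3 by (simp add: algebra_simps)
  finally show False using contr by simp
qed

section \<open>Convexity from hinge functions\<close>

lemma convex_on_UNIV_subgradient:
  fixes f :: "real \<Rightarrow> real"
  assumes "convex_on UNIV f"
  obtains g where "mono g" "\<And>x y. f x + g x * (y - x) \<le> f y"
proof -
  define g where "g x = Inf ((\<lambda>t. (f x - f t) / (x - t)) ` ({x<..} \<inter> UNIV))" for x
  have g: "f x + g x * (y - x) \<le> f y" for x y
    unfolding g_def by (rule convex_le_Inf_differential[OF assms]) auto
  have "mono g"
  proof (rule monoI)
    fix x y :: real assume "x \<le> y"
    show "g x \<le> g y"
    proof (cases "x = y")
      case False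
      have "g x * (y - x) \<le> g y * (y - x)" using g[of x y] g[of y x] by (simp add: algebra_simps)
      then show ?thesis using False \<open>x \<le> y\<close> by simp
    qed simp
  qed
  then show thesis using g that by blast
qed

definition tangent :: "(real \<Rightarrow> real) \<Rightarrow> (real \<Rightarrow> real) \<Rightarrow> real \<Rightarrow> real \<Rightarrow> real" where
  "tangent f g q w = f q + g q * (w - q)"

text \<open>For sorted nodes this is the maximum of the tangents at \<open>q 0, \<dots>, q n\<close>. The telescoping form is the
  one that displays it as an affine function plus hinges.\<close>

definition tangent_envelope ::
    "(real \<Rightarrow> real) \<Rightarrow> (real \<Rightarrow> real) \<Rightarrow> (nat \<Rightarrow> real) \<Rightarrow> nat \<Rightarrow> real \<Rightarrow> real" where
  "tangent_envelope f g q n w = tangent f g (q 0) w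
     + (\<Sum>i<n. max 0 (tangent f g (q (Suc i)) w - tangent f g (q i) w))"

context
  fixes f g :: "real \<Rightarrow> real"
  assumes mono_g: "mono g" and sub: "\<And>x y. f x + g x * (y - x) \<le> f y"
begin

lemma tangent_le: "tangent f g q w \<le> f w"
  using sub by (simp add: tangent_def)

text \<open>Of two tangents, the one touching closer to \<open>w\<close> is the larger at \<open>w\<close>, as long as \<open>w\<close> is not
  between the two nodes.\<close>

lemma tangent_order:
  assumes "q \<le> q'"
  shows "q' \<le> w \<Longrightarrow> tangent f g q w \<le> tangent f g q' w"
    and "w \<le> q \<Longrightarrow> tangent f g q' w \<le> tangent f g q w"
proof -
  have g: "g q \<le> g q'" using mono_g assms by (simp add: monoD)
  show "tangent f g q w \<le> tangent f g q' w" if "q' \<le> w"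
  proof -
    have "g q * (w - q') \<le> g q' * (w - q')" using that g by (intro mult_right_mono) auto
    then show ?thesis using sub[of q q'] by (simp add: tangent_def algebra_simps)
  qed
  show "tangent f g q' w \<le> tangent f g q w" if "w \<le> q"
  proof -
    have "g q' * (w - q) \<le> g q * (w - q)" using that g by (intro mult_right_mono_neg) auto
    then show ?thesis using sub[of q' q] by (simp add: tangent_def algebra_simps)
  qed
qed

lemma tangent_diff_hinge:
  assumes "q \<le> q'"
  obtains \<sigma> d where "0 \<le> \<sigma>" "\<And>w. max 0 (tangent f g q' w - tangent f g q w) = \<sigma> * max 0 (w - d)"
proof (cases "g q = g q'")
  case True
  have "tangent f g q' w = tangent f g q w" for w
    using sub[of q q'] sub[of q' q] True by (simp add: tangent_def algebra_simps)
  then show thesis using that[of 0 0] by simp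
next
  case False
  define \<sigma> where "\<sigma> = g q' - g q"
  have "\<sigma> > 0" using False monoD[OF mono_g assms] by (simp add: \<sigma>_def)
  define d where "d = - (f q' - g q' * q' - f q + g q * q) / \<sigma>"
  have "tangent f g q' w - tangent f g q w = \<sigma> * (w - d)" for w
  proof -
    have "\<sigma> * d = - (f q' - g q' * q' - f q + g q * q)" using \<open>\<sigma> > 0\<close> by (simp add: d_def)
    then show ?thesis by (simp add: tangent_def \<sigma>_def algebra_simps)
  qed
  then show thesis using that[of \<sigma> d] \<open>\<sigma> > 0\<close> by (simp add: max_mult_distrib_left)
qed

text \<open>The three claims together say that the envelope is the maximum of the tangents. Beyond the last node
  \<open>q n\<close> it is the last tangent, so adding the next summand replaces it by the maximum of the last two;
  before \<open>q n\<close> that summand is zero.\<close>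

lemma tangent_envelope_bounds:
  assumes "mono q"
  shows "tangent_envelope f g q n w \<le> f w"
    and "q n \<le> w \<Longrightarrow> tangent_envelope f g q n w = tangent f g (q n) w"
    and "i \<le> n \<Longrightarrow> tangent f g (q i) w \<le> tangent_envelope f g q n w"
proof (induction n)
  case 0
  { case 1 show ?case by (simp add: tangent_envelope_def tangent_le) }
  { case 2 show ?case by (simp add: tangent_envelope_def) }
  { case 3 then show ?case by (simp add: tangent_envelope_def) }
next
  case (Suc n)
  have q: "q n \<le> q (Suc n)" using assms by (simp add: monoD)
  let ?l = "\<lambda>i. tangent f g (q i) w"
  have step: "tangent_envelope f g q (Suc n) w = tangent_envelope f g q n w + max 0 (?l (Suc n) - ?l n)"
    by (simp add: tangent_envelope_def)
  { case 1
    show ?case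
    proof (cases "q n \<le> w")
      case True
      then show ?thesis using Suc(2)[OF True] step tangent_le[of "q n" w] tangent_le[of "q (Suc n)" w]
        by (simp add: max_def)
    next
      case False
      then show ?thesis using Suc(1) step tangent_order(2)[OF q, of w] by simp
    qed }
  { case 2
    then show ?case using Suc(2) step tangent_order(1)[OF q, of w] q by simp }
  { case 3
    show ?case
    proof (cases "i \<le> n")
      case True
      then show ?thesis using Suc(3)[OF True] step by simp
    next
      case False
      then have i: "i = Suc n" using 3 by simp
      show ?thesis
      proof (cases "q n \<le> w")
        case True
        then show ?thesis using Suc(2)[OF True] step i by simp
      next
        case False
        then have "?l (Suc n) \<le> ?l n" using tangent_order(2)[OF q, of w] by simp
        moreover have "?l n \<le> tangent_envelope f g q n w"
          by (induction n) (auto simp: tangent_envelope_def)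
        ultimately show ?thesis using step i by simp
      qed
    qed }
qed


text \<open>The grid has mesh \<open>1 / (n + 1)\<close> and reaches from \<open>-(n + 1)\<close> to \<open>n + 1\<close>. Its node with index \<open>N n\<close>
  is the origin, so the envelopes have the common affine minorant \<open>tangent f g 0\<close>, which provides the
  domination in the limit.\<close>

lemma tangent_envelope_grid_tendsto:
  defines "grid n \<equiv> (\<lambda>i::nat. (real i - (real n + 1)\<^sup>2) / (real n + 1))"
  defines "N n \<equiv> (n + 1)\<^sup>2"
  shows "(\<lambda>n. tangent_envelope f g (grid n) (2 * N n) w) \<longlonglongrightarrow> f w"
    and "tangent f g 0 w \<le> tangent_envelope f g (grid n) (2 * N n) w"
    and "tangent_envelope f g (grid n) (2 * N n) w \<le> f w"
proof -
  have mono: "mono (grid n)" for n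
    unfolding grid_def by (intro monoI divide_right_mono) auto
  show le: "tangent_envelope f g (grid n) (2 * N n) w \<le> f w" for n
    by (rule tangent_envelope_bounds(1)[OF mono])
  have "grid n (N n) = 0" by (simp add: grid_def N_def add.commute)
  then show "tangent f g 0 w \<le> tangent_envelope f g (grid n) (2 * N n) w" for n
    using tangent_envelope_bounds(3)[OF mono[of n], of "N n" "2 * N n" w] by (simp add: grid_def N_def add.commute)
  have ge: "f w - (g w - g (w - 1)) / (real n + 1) \<le> tangent_envelope f g (grid n) (2 * N n) w"
    if n: "\<bar>w\<bar> \<le> real n + 1" for n
  proof -
    define D where "D = real n + 1"
    have "D \<ge> 1" by (simp add: D_def)
    define j where "j = \<lfloor>w * D\<rfloor>"
    have N: "real (N n) = D * D" by (simp add: N_def D_def power2_eq_square algebra_simps)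
    have "\<bar>w * D\<bar> \<le> D * D"
      using n \<open>D \<ge> 1\<close> by (simp add: abs_mult D_def mult_right_mono)
    then have w: "- real (N n) \<le> w * D" "w * D \<le> real (N n)" using N by auto
    have "- int (N n) \<le> j" "j \<le> int (N n)"
      unfolding j_def using w by (simp_all add: le_floor_iff floor_le_iff)
    define i where "i = nat (j + int (N n))"
    have i: "real i = real_of_int j + D * D" "i \<le> 2 * N n"
      using \<open>- int (N n) \<le> j\<close> \<open>j \<le> int (N n)\<close> N by (auto simp: i_def nat_le_iff)
    define x where "x = grid n i"
    have x: "x = real_of_int j / D"
      unfolding x_def grid_def using i(1) by (simp add: D_def power2_eq_square)
    have "real_of_int j \<le> w * D" "w * D \<le> real_of_int j + 1" by (auto simp: j_def)
    then have "x \<le> w" "w \<le> (real_of_int j + 1) / D"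
      unfolding x using \<open>D \<ge> 1\<close> by (simp_all add: pos_divide_le_eq pos_le_divide_eq)
    moreover have "1 / D \<le> 1" using \<open>D \<ge> 1\<close> by simp
    ultimately have xw: "x \<le> w" "w - x \<le> 1 / D" "w - x \<le> 1"
      unfolding x by (simp_all add: add_divide_distrib)
    have "(g w - g x) * (w - x) \<le> (g w - g (w - 1)) * (1 / D)"
      using xw monoD[OF mono_g, of "w - 1" x] monoD[OF mono_g, of x w]
      by (intro mult_mono) auto
    then have "(g w - g x) * (w - x) \<le> (g w - g (w - 1)) / D" by simp
    then have "f w - (g w - g (w - 1)) / D \<le> tangent f g x w"
      using sub[of w x] unfolding tangent_def left_diff_distrib right_diff_distrib by linarith
    also have "\<dots> \<le> tangent_envelope f g (grid n) (2 * N n) w"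
      unfolding x_def by (rule tangent_envelope_bounds(3)[OF mono i(2)])
    finally show ?thesis by (simp add: D_def)
  qed
  show "(\<lambda>n. tangent_envelope f g (grid n) (2 * N n) w) \<longlonglongrightarrow> f w"
  proof (rule tendsto_sandwich)
    show "eventually (\<lambda>n. f w - (g w - g (w - 1)) / (real n + 1)
        \<le> tangent_envelope f g (grid n) (2 * N n) w) sequentially"
      using eventually_ge_at_top[of "nat \<lceil>\<bar>w\<bar>\<rceil>"]
      by (rule eventually_mono) (intro ge, linarith)
    show "(\<lambda>n. f w - (g w - g (w - 1)) / (real n + 1)) \<longlonglongrightarrow> f w"
    proof -
      have "(\<lambda>n. f w - (g w - g (w - 1)) * inverse (real (Suc n))) \<longlonglongrightarrow> f w - (g w - g (w - 1)) * 0"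
        by (intro tendsto_intros LIMSEQ_inverse_real_of_nat)
      then show ?thesis by (simp add: divide_inverse add.commute)
    qed
  qed (use le in auto)
qed

end

lemma convex_on_eq:
  assumes "convex_on J G" and eq: "\<And>z. z \<in> J \<Longrightarrow> H z = G z"
  shows "convex_on J H"
  using assms(1) unfolding convex_on_def by (simp add: eq convexD)

lemma convex_on_limit:
  fixes F :: "real \<Rightarrow> real"
  assumes conv: "\<And>n::nat. convex_on J (G n)" and lim: "\<And>z. z \<in> J \<Longrightarrow> (\<lambda>n. G n z) \<longlonglongrightarrow> F z"
  shows "convex_on J F"
proof (rule convex_onI)
  show "convex J" using conv by (auto simp: convex_on_def)
  fix s x y :: real assume s: "0 < s" "s < 1" and xy: "x \<in> J" "y \<in> J"
  then have "(1 - s) *\<^sub>R x + s *\<^sub>R y \<in> J"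
    using \<open>convex J\<close> by (intro convexD_alt) auto
  then show "F ((1 - s) *\<^sub>R x + s *\<^sub>R y) \<le> (1 - s) * F x + s * F y"
    using xy s conv[THEN convex_onD, of s x y]
    by (intro LIMSEQ_le[OF lim tendsto_add[OF tendsto_mult_left[OF lim] tendsto_mult_left[OF lim]]]) auto
qed

lemma convex_on_integral_from_hinges:
  fixes K :: "real \<Rightarrow> real measure" and f :: "real \<Rightarrow> real"
  assumes J: "convex J"
    and prob: "\<And>z. z \<in> J \<Longrightarrow> prob_space (K z)"
    and sets: "\<And>z. z \<in> J \<Longrightarrow> sets (K z) = sets borel"
    and int: "\<And>z. z \<in> J \<Longrightarrow> integrable (K z) (\<lambda>w. w)"
    and mean: "\<And>z. z \<in> J \<Longrightarrow> (\<integral>w. w \<partial>K z) = z"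
    and hinge: "\<And>c. convex_on J (\<lambda>z. \<integral>w. max 0 (w - c) \<partial>K z)"
    and f: "convex_on UNIV f" and f_int: "\<And>z. z \<in> J \<Longrightarrow> integrable (K z) f"
  shows "convex_on J (\<lambda>z. \<integral>w. f w \<partial>K z)"
proof -
  obtain g where g: "mono g" "\<And>x y. f x + g x * (y - x) \<le> f y"
    using convex_on_UNIV_subgradient[OF f] by metis
  have [simp]: "measure (K z) (space (K z)) = 1" "finite_measure (K z)" if "z \<in> J" for z
    using prob[OF that] by (simp_all add: prob_space.prob_space prob_space.finite_measure)
  have [simp]: "integrable (K z) (\<lambda>_. c)" if "z \<in> J" for z and c :: real
    using that by (simp add: finite_measure.integrable_const)
  have [simp]: "integrable (K z) (\<lambda>w. max 0 (w - c))" if "z \<in> J" for z c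
    using that int by (intro integrable_max) auto
  have tangent: "integrable (K z) (tangent f g q)" "(\<integral>w. tangent f g q w \<partial>K z) = f q + g q * (z - q)"
    if "z \<in> J" for z q
    unfolding tangent_def using that int mean by (simp_all add: algebra_simps)
  have env: "(\<forall>z\<in>J. integrable (K z) (tangent_envelope f g q n)) \<and>
      convex_on J (\<lambda>z. \<integral>w. tangent_envelope f g q n w \<partial>K z)" if "mono q" for q n
  proof (induction n)
    case 0
    have "convex_on J (\<lambda>z. f (q 0) + g (q 0) * (z - q 0))"
    proof (rule convex_onI)
      fix s x y :: real
      show "f (q 0) + g (q 0) * ((1 - s) *\<^sub>R x + s *\<^sub>R y - q 0)
          \<le> (1 - s) * (f (q 0) + g (q 0) * (x - q 0)) + s * (f (q 0) + g (q 0) * (y - q 0))"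
        by (simp add: algebra_simps)
    qed (rule J)
    then have "convex_on J (\<lambda>z. \<integral>w. tangent_envelope f g q 0 w \<partial>K z)"
      by (rule convex_on_eq) (simp add: tangent_envelope_def tangent)
    then show ?case using tangent by (simp add: tangent_envelope_def[abs_def])
  next
    case (Suc n)
    obtain \<sigma> d where \<sigma>: "0 \<le> \<sigma>"
      "\<And>w. max 0 (tangent f g (q (Suc n)) w - tangent f g (q n) w) = \<sigma> * max 0 (w - d)"
      using tangent_diff_hinge[OF g, of "q n" "q (Suc n)"] \<open>mono q\<close> by (metis monoD lessI less_imp_le)
    have step: "tangent_envelope f g q (Suc n) = (\<lambda>w. tangent_envelope f g q n w + \<sigma> * max 0 (w - d))"
      using \<sigma>(2) by (simp add: tangent_envelope_def fun_eq_iff)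
    have "convex_on J (\<lambda>z. (\<integral>w. tangent_envelope f g q n w \<partial>K z) + \<sigma> * (\<integral>w. max 0 (w - d) \<partial>K z))"
      using Suc \<sigma>(1) hinge by (intro convex_on_add convex_on_cmul) auto
    then have "convex_on J (\<lambda>z. \<integral>w. tangent_envelope f g q (Suc n) w \<partial>K z)"
      by (rule convex_on_eq) (simp add: step Suc)
    then show ?case using Suc by (simp add: step)
  qed
  define grid where "grid n = (\<lambda>i::nat. (real i - (real n + 1)\<^sup>2) / (real n + 1))" for n
  define e where "e n = tangent_envelope f g (grid n) (2 * (n + 1)\<^sup>2)" for n
  have mono: "mono (grid n)" for n
    unfolding grid_def by (intro monoI divide_right_mono) auto
  note lim = tangent_envelope_grid_tendsto[OF g, folded grid_def e_def]
  show ?thesis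
  proof (rule convex_on_limit)
    show "convex_on J (\<lambda>z. \<integral>w. e n w \<partial>K z)" for n using env[OF mono] by (simp add: e_def)
    fix z assume z: "z \<in> J"
    show "(\<lambda>n. \<integral>w. e n w \<partial>K z) \<longlonglongrightarrow> (\<integral>w. f w \<partial>K z)"
    proof (rule integral_dominated_convergence)
      show "integrable (K z) (\<lambda>w. \<bar>f w\<bar> + \<bar>tangent f g 0 w\<bar>)"
        using z f_int tangent by auto
      show "AE w in K z. (\<lambda>n. e n w) \<longlonglongrightarrow> f w" using lim(1) by simp
      show "AE w in K z. norm (e n w) \<le> \<bar>f w\<bar> + \<bar>tangent f g 0 w\<bar>" for n
      proof (rule AE_I2)
        fix w show "norm (e n w) \<le> \<bar>f w\<bar> + \<bar>tangent f g 0 w\<bar>"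
          using lim(2)[where w = w and n = n] lim(3)[where w = w and n = n] by (auto simp: abs_le_iff)
      qed
    qed (use z f_int env[OF mono] in \<open>auto simp: e_def intro: borel_measurable_integrable\<close>)
  qed
qed

section \<open>Sums of observations from an exponential family\<close>

lemma density_PiM:
  fixes M :: "'i \<Rightarrow> 'a measure" and f :: "'i \<Rightarrow> 'a \<Rightarrow> ennreal"
  assumes I: "finite I" and sf: "\<And>i. sigma_finite_measure (M i)"
    and sf': "\<And>i. sigma_finite_measure (density (M i) (f i))"
    and f[measurable]: "\<And>i. f i \<in> borel_measurable (M i)"
  shows "Pi\<^sub>M I (\<lambda>i. density (M i) (f i)) = density (Pi\<^sub>M I M) (\<lambda>\<omega>. \<Prod>i\<in>I. f i (\<omega> i))"
proof -
  interpret M: product_sigma_finite M using sf by (simp add: product_sigma_finite_def)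
  interpret D: product_sigma_finite "\<lambda>i. density (M i) (f i)" using sf' by (simp add: product_sigma_finite_def)
  show ?thesis
  proof (rule D.PiM_eqI[symmetric, OF I])
    show "sets (density (Pi\<^sub>M I M) (\<lambda>\<omega>. \<Prod>i\<in>I. f i (\<omega> i))) = sets (Pi\<^sub>M I (\<lambda>i. density (M i) (f i)))"
      by (simp cong: sets_PiM_cong)
    fix A assume "\<And>i. i \<in> I \<Longrightarrow> A i \<in> sets (density (M i) (f i))"
    then have A[measurable]: "\<And>i. i \<in> I \<Longrightarrow> A i \<in> sets (M i)" by simp
    have "emeasure (density (Pi\<^sub>M I M) (\<lambda>\<omega>. \<Prod>i\<in>I. f i (\<omega> i))) (Pi\<^sub>E I A)
        = (\<integral>\<^sup>+\<omega>. (\<Prod>i\<in>I. f i (\<omega> i)) * indicator (Pi\<^sub>E I A) \<omega> \<partial>Pi\<^sub>M I M)"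
      using I by (intro emeasure_density) (auto intro!: sets_PiM_I_finite)
    also have "\<dots> = (\<integral>\<^sup>+\<omega>. (\<Prod>i\<in>I. f i (\<omega> i) * indicator (A i) (\<omega> i)) \<partial>Pi\<^sub>M I M)"
    proof (rule nn_integral_cong)
      fix \<omega> assume "\<omega> \<in> space (Pi\<^sub>M I M)"
      then have "indicator (Pi\<^sub>E I A) \<omega> = (\<Prod>i\<in>I. indicator (A i) (\<omega> i) :: ennreal)"
      proof (cases "\<forall>i\<in>I. \<omega> i \<in> A i")
        case True
        then show ?thesis using \<open>\<omega> \<in> space (Pi\<^sub>M I M)\<close> by (simp add: PiE_iff space_PiM)
      next
        case False
        then have "(\<Prod>i\<in>I. indicator (A i) (\<omega> i) :: ennreal) = 0"
          using I by (intro prod_zero) (auto simp: indicator_def)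
        then show ?thesis using False by (auto simp: PiE_iff)
      qed
      then show "(\<Prod>i\<in>I. f i (\<omega> i)) * indicator (Pi\<^sub>E I A) \<omega> = (\<Prod>i\<in>I. f i (\<omega> i) * indicator (A i) (\<omega> i))"
        by (simp add: prod.distrib)
    qed
    also have "\<dots> = (\<Prod>i\<in>I. \<integral>\<^sup>+x. f i x * indicator (A i) x \<partial>M i)"
      using I by (intro M.product_nn_integral_prod) auto
    also have "\<dots> = (\<Prod>i\<in>I. emeasure (density (M i) (f i)) (A i))"
      using I by (intro prod.cong refl) (simp add: emeasure_density)
    finally show "emeasure (density (Pi\<^sub>M I M) (\<lambda>\<omega>. \<Prod>i\<in>I. f i (\<omega> i))) (Pi\<^sub>E I A)
        = (\<Prod>i\<in>I. emeasure (density (M i) (f i)) (A i))" .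
  qed
qed

locale exp_family =
  fixes \<nu> :: "real measure"
  assumes sigma_finite_\<nu>: "sigma_finite_measure \<nu>" and sets_\<nu>[measurable_cong]: "sets \<nu> = sets borel"
    and \<nu>_nonzero: "emeasure \<nu> UNIV \<noteq> 0"
begin

lemma space_\<nu>[simp]: "space \<nu> = UNIV"
  using sets_eq_imp_space_eq[OF sets_\<nu>] by simp

lemma sets_exp_law[measurable_cong]: "sets (exp_law \<nu> u) = sets borel"
  by (simp add: exp_law_def sets_\<nu>)

lemma sets_sum_law[measurable_cong, simp]: "sets (sum_law \<nu> k u) = sets borel"
  by (simp add: sum_law_def)

lemma space_sum_law[simp]: "space (sum_law \<nu> k u) = UNIV"
  by (simp add: sum_law_def)

lemma measurable_cumulant[measurable]: "cumulant \<nu> \<in> borel_measurable borel"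
proof -
  interpret sigma_finite_measure \<nu> by (rule sigma_finite_\<nu>)
  show ?thesis unfolding cumulant_def[abs_def] by measurable
qed

lemma measurable_lik_ratio[measurable]:
  "(\<lambda>(u, x). lik_ratio \<nu> us k u x) \<in> borel_measurable (borel \<Otimes>\<^sub>M borel)"
  unfolding lik_ratio_def by measurable

lemma prob_space_exp_law:
  assumes "u \<in> nat_dom \<nu>"
  shows "prob_space (exp_law \<nu> u)"
proof
  have fin: "(\<integral>\<^sup>+x. ennreal (exp (u * x)) \<partial>\<nu>) < \<infinity>" using assms by (simp add: nat_dom_def)
  have int: "integrable \<nu> (\<lambda>x. exp (u * x))"
    using fin by (intro integrableI_nonneg) auto
  have "(\<integral>x. exp (u * x) \<partial>\<nu>) \<noteq> 0"
  proof
    assume "(\<integral>x. exp (u * x) \<partial>\<nu>) = 0"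
    then have "AE x in \<nu>. exp (u * x) = 0"
      using integral_nonneg_eq_0_iff_AE[OF int] by simp
    then show False using \<nu>_nonzero by (simp add: AE_iff_measurable[OF sets.top])
  qed
  then have pos: "0 < (\<integral>x. exp (u * x) \<partial>\<nu>)" by (simp add: less_le)
  have "emeasure (exp_law \<nu> u) (space (exp_law \<nu> u)) = (\<integral>\<^sup>+x. ennreal (exp (u * x - cumulant \<nu> u)) \<partial>\<nu>)"
    unfolding exp_law_def by (simp add: emeasure_density)
  also have "\<dots> = (\<integral>\<^sup>+x. ennreal (exp (u * x)) * ennreal (exp (- cumulant \<nu> u)) \<partial>\<nu>)"
    by (intro nn_integral_cong) (simp flip: ennreal_mult' exp_add)
  also have "\<dots> = ennreal (\<integral>x. exp (u * x) \<partial>\<nu>) * ennreal (exp (- cumulant \<nu> u))"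
    by (subst nn_integral_multc) (simp_all add: nn_integral_eq_integral[OF int])
  also have "\<dots> = 1"
    using pos by (simp add: cumulant_def exp_minus flip: ennreal_mult')
  finally show "emeasure (exp_law \<nu> u) (space (exp_law \<nu> u)) = 1" .
qed

lemma prob_space_sum_law:
  assumes "u \<in> nat_dom \<nu>"
  shows "prob_space (sum_law \<nu> k u)"
proof -
  interpret prob_space "Pi\<^sub>M {..<k} (\<lambda>_. exp_law \<nu> u)"
    by (intro prob_space_PiM prob_space_exp_law assms)
  have "(\<lambda>\<omega>. \<Sum>i<k. \<omega> i) \<in> borel_measurable (Pi\<^sub>M {..<k} (\<lambda>_. exp_law \<nu> u))"
    by measurable
  then show ?thesis unfolding sum_law_def by (rule prob_space_distr)
qed

text \<open>The density of the product law is a product of one-observation likelihood ratios and depends on the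
  sample only through its sum, so it passes to the law of the sum.\<close>

lemma sum_law_eq_density:
  assumes u: "u \<in> nat_dom \<nu>" and us: "us \<in> nat_dom \<nu>"
  shows "sum_law \<nu> k u = density (sum_law \<nu> k us) (\<lambda>x. ennreal (lik_ratio \<nu> us k u x))"
proof -
  define r where "r x = ennreal (lik_ratio \<nu> us 1 u x)" for x
  have [measurable]: "r \<in> borel_measurable borel" unfolding r_def[abs_def] by measurable
  have one: "exp_law \<nu> u = density (exp_law \<nu> us) r"
    unfolding exp_law_def r_def lik_ratio_def
    by (subst density_density_eq) (auto simp: algebra_simps simp flip: ennreal_mult' exp_add intro!: density_cong)
  have sf: "sigma_finite_measure (exp_law \<nu> v)" if "v \<in> nat_dom \<nu>" for v
  proof -
    interpret prob_space "exp_law \<nu> v" by (rule prob_space_exp_law[OF that])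
    show ?thesis by unfold_locales
  qed
  have prod: "(\<Prod>i<k. r (\<omega> i)) = ennreal (lik_ratio \<nu> us k u (\<Sum>i<k. \<omega> i))" for \<omega> :: "nat \<Rightarrow> real"
    unfolding r_def lik_ratio_def
    by (subst prod_ennreal) (simp_all add: sum_subtractf sum_distrib_left flip: exp_sum)
  have "Pi\<^sub>M {..<k} (\<lambda>_. exp_law \<nu> u) = density (Pi\<^sub>M {..<k} (\<lambda>_. exp_law \<nu> us)) (\<lambda>\<omega>. \<Prod>i<k. r (\<omega> i))"
    unfolding one using sf[OF us] sf[OF u] by (intro density_PiM) (auto simp: one)
  then show ?thesis
    unfolding sum_law_def prod by (subst density_distr) simp_all
qed

text \<open>The likelihood ratio of \<open>v\<close> against \<open>u\<close> increases in the observation. Hence either it is at least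
  \<open>1\<close> on all of \<open>C\<close>, or it is at most \<open>1\<close> on all of the complement; in the second case the
  complements are compared.\<close>

lemma sum_law_upset_mono:
  assumes u: "u \<in> nat_dom \<nu>" and v: "v \<in> nat_dom \<nu>" and "u \<le> v"
    and C[measurable]: "C \<in> sets borel" and up: "\<And>x x'. x \<in> C \<Longrightarrow> x \<le> x' \<Longrightarrow> x' \<in> C"
  shows "measure (sum_law \<nu> k u) C \<le> measure (sum_law \<nu> k v) C"
proof -
  interpret U: prob_space "sum_law \<nu> k u" by (rule prob_space_sum_law[OF u])
  interpret V: prob_space "sum_law \<nu> k v" by (rule prob_space_sum_law[OF v])
  have V: "emeasure (sum_law \<nu> k v) A = (\<integral>\<^sup>+x. ennreal (lik_ratio \<nu> u k v x) * indicator A x \<partial>sum_law \<nu> k u)"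
    if "A \<in> sets borel" for A
    using that by (subst sum_law_eq_density[OF v u]) (simp add: emeasure_density)
  have U: "emeasure (sum_law \<nu> k u) A = (\<integral>\<^sup>+x. indicator A x \<partial>sum_law \<nu> k u)" if "A \<in> sets borel" for A
    using that by simp
  have mono: "lik_ratio \<nu> u k v x \<le> lik_ratio \<nu> u k v x'" if "x \<le> x'" for x x'
    using \<open>u \<le> v\<close> that by (simp add: lik_ratio_def mult_left_mono)
  show ?thesis
  proof (cases "\<exists>x\<in>C. lik_ratio \<nu> u k v x < 1")
    case True
    then obtain x0 where x0: "x0 \<in> C" "lik_ratio \<nu> u k v x0 < 1" by blast
    have "lik_ratio \<nu> u k v x \<le> 1" if "x \<notin> C" for x
      using up[OF x0(1), of x] that mono[of x x0] x0(2) by linarith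
    then have "emeasure (sum_law \<nu> k v) (- C) \<le> emeasure (sum_law \<nu> k u) (- C)"
      unfolding V[OF borel_comp[OF C]] U[OF borel_comp[OF C]]
      by (intro nn_integral_mono) (auto split: split_indicator)
    then have "measure (sum_law \<nu> k v) (- C) \<le> measure (sum_law \<nu> k u) (- C)"
      by (simp add: U.emeasure_eq_measure V.emeasure_eq_measure)
    then show ?thesis
      using U.prob_compl[of C] V.prob_compl[of C] C by (simp add: Compl_eq_Diff_UNIV)
  next
    case False
    then have "emeasure (sum_law \<nu> k u) C \<le> emeasure (sum_law \<nu> k v) C"
      unfolding V[OF C] U[OF C]
      by (intro nn_integral_mono) (auto split: split_indicator simp: not_less)
    then show ?thesis by (simp add: U.emeasure_eq_measure V.emeasure_eq_measure)
  qed
qed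

end

section \<open>One Bayes update\<close>

text \<open>A prior \<open>m\<close>, an observation with density \<open>l u\<close> against a reference law \<open>R\<close> given the parameter \<open>u\<close>,
  and an integrable function \<open>\<tau>\<close> of the parameter. Normalisation of \<open>l u\<close> is asked only for \<open>m\<close>-almost
  every \<open>u\<close>, since the exponential family is normalised only for natural parameters. The number \<open>z\<close>
  is the default value of the updated mean.\<close>

locale bayes_update =
  M: prob_space m + R: prob_space R for m R :: "real measure" +
  fixes l :: "real \<Rightarrow> real \<Rightarrow> real" and \<tau> :: "real \<Rightarrow> real" and z :: real
  assumes sets_m[measurable_cong]: "sets m = sets borel" and sets_R[measurable_cong]: "sets R = sets borel"
    and l_meas: "case_prod l \<in> borel_measurable (borel \<Otimes>\<^sub>M borel)"
    and l_pos: "\<And>u x. 0 < l u x"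
    and l_one: "AE u in m. (\<integral>\<^sup>+x. ennreal (l u x) \<partial>R) = 1"
    and \<tau>_meas[measurable]: "\<tau> \<in> borel_measurable borel" and \<tau>_int: "integrable m \<tau>"
begin

sublocale pair_sigma_finite m R ..

lemma space_mR[simp]: "space m = UNIV" "space R = UNIV"
  using sets_eq_imp_space_eq[OF sets_m] sets_eq_imp_space_eq[OF sets_R] by simp_all

lemma l_meas'[measurable (raw)]:
  "f \<in> borel_measurable M \<Longrightarrow> g \<in> borel_measurable M \<Longrightarrow> (\<lambda>x. l (f x) (g x)) \<in> borel_measurable M"
  using measurable_compose[OF measurable_Pair[of f M borel g borel] l_meas] by simp

definition marg :: "real \<Rightarrow> ennreal" where
  "marg x = (\<integral>\<^sup>+u. ennreal (l u x) \<partial>m)"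

definition abs_marg :: "real \<Rightarrow> ennreal" where
  "abs_marg x = (\<integral>\<^sup>+u. ennreal (\<bar>\<tau> u\<bar> * l u x) \<partial>m)"

definition updated_mean :: "real \<Rightarrow> real" where
  "updated_mean x = (if 0 < marg x \<and> marg x < \<infinity> \<and> abs_marg x < \<infinity>
     then (\<integral>u. \<tau> u * l u x \<partial>m) / enn2real (marg x) else z)"

definition predictive :: "real measure" where
  "predictive = density R marg"

lemma marg_meas[measurable]: "marg \<in> borel_measurable borel"
  unfolding marg_def[abs_def] by measurable

lemma abs_marg_meas[measurable]: "abs_marg \<in> borel_measurable borel"
  unfolding abs_marg_def[abs_def] by measurable

lemma updated_mean_meas[measurable]: "updated_mean \<in> borel_measurable borel"
  unfolding updated_mean_def[abs_def] by measurable

lemma sets_predictive[measurable_cong, simp]: "sets predictive = sets borel"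
  by (simp add: predictive_def sets_R)

lemma nn_integral_predictive:
  assumes [measurable]: "g \<in> borel_measurable borel"
  shows "(\<integral>\<^sup>+u. (\<integral>\<^sup>+x. g x \<partial>density R (\<lambda>x. ennreal (l u x))) \<partial>m) = (\<integral>\<^sup>+x. g x \<partial>predictive)"
proof -
  have "(\<integral>\<^sup>+u. (\<integral>\<^sup>+x. g x \<partial>density R (\<lambda>x. ennreal (l u x))) \<partial>m)
      = (\<integral>\<^sup>+u. (\<integral>\<^sup>+x. ennreal (l u x) * g x \<partial>R) \<partial>m)"
    by (intro nn_integral_cong nn_integral_density) simp_all
  also have "\<dots> = (\<integral>\<^sup>+x. (\<integral>\<^sup>+u. ennreal (l u x) * g x \<partial>m) \<partial>R)"
    by (rule Fubini'[symmetric]) simp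
  also have "\<dots> = (\<integral>\<^sup>+x. marg x * g x \<partial>R)"
    unfolding marg_def by (intro nn_integral_cong nn_integral_multc) simp
  also have "\<dots> = (\<integral>\<^sup>+x. g x \<partial>predictive)"
    unfolding predictive_def by (subst nn_integral_density) simp_all
  finally show ?thesis .
qed

lemma prob_space_predictive: "prob_space predictive"
proof
  have "emeasure predictive (space predictive) = (\<integral>\<^sup>+x. 1 \<partial>predictive)" by simp
  also have "\<dots> = (\<integral>\<^sup>+u. (\<integral>\<^sup>+x. 1 \<partial>density R (\<lambda>x. ennreal (l u x))) \<partial>m)"
    by (rule nn_integral_predictive[symmetric]) simp
  also have "\<dots> = (\<integral>\<^sup>+u. 1 \<partial>m)"
    using l_one by (intro nn_integral_cong_AE) (auto simp: nn_integral_density simp del: nn_integral_const)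
  also have "\<dots> = 1" using M.emeasure_space_1 by simp
  finally show "emeasure predictive (space predictive) = 1" .
qed

lemma marg_pos: "0 < marg x"
proof -
  have "marg x \<noteq> 0"
  proof
    assume "marg x = 0"
    then have "AE u in m. ennreal (l u x) = 0"
      unfolding marg_def by (subst (asm) nn_integral_0_iff_AE) simp_all
    then have "AE u in m. False" using l_pos by (auto simp: ennreal_eq_0_iff not_le[symmetric])
    then show False by simp
  qed
  then show ?thesis by (simp add: zero_less_iff_neq_zero)
qed

text \<open>Both functions have a finite integral against \<open>R\<close>, so the default value of the updated mean is taken
  with probability zero only.\<close>

lemma AE_marg_finite: "AE x in R. marg x < \<infinity> \<and> abs_marg x < \<infinity>"
proof -
  have "(\<integral>\<^sup>+x. marg x \<partial>R) = (\<integral>\<^sup>+u. (\<integral>\<^sup>+x. ennreal (l u x) \<partial>R) \<partial>m)"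
    unfolding marg_def by (rule Fubini') simp
  also have "\<dots> = (\<integral>\<^sup>+u. 1 \<partial>m)" using l_one by (intro nn_integral_cong_AE) auto
  finally have "(\<integral>\<^sup>+x. marg x \<partial>R) \<noteq> \<infinity>" by (simp add: M.emeasure_space_1)
  then have 1: "AE x in R. marg x \<noteq> \<infinity>" by (intro nn_integral_PInf_AE) simp_all
  have "(\<integral>\<^sup>+x. abs_marg x \<partial>R) = (\<integral>\<^sup>+u. (\<integral>\<^sup>+x. ennreal (\<bar>\<tau> u\<bar> * l u x) \<partial>R) \<partial>m)"
    unfolding abs_marg_def by (rule Fubini') simp
  also have "\<dots> = (\<integral>\<^sup>+u. ennreal \<bar>\<tau> u\<bar> \<partial>m)"
    using l_one by (intro nn_integral_cong_AE) (auto simp: ennreal_mult' nn_integral_cmult)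
  also have "\<dots> \<noteq> \<infinity>" using \<tau>_int by (simp add: integrable_iff_bounded)
  finally have 2: "AE x in R. abs_marg x \<noteq> \<infinity>" by (intro nn_integral_PInf_AE) simp_all
  show ?thesis using 1 2 by eventually_elim (simp add: less_top)
qed

lemma
  assumes "marg x < \<infinity>" "abs_marg x < \<infinity>"
  shows integrable_l: "integrable m (\<lambda>u. l u x)"
    and integrable_\<tau>_l: "integrable m (\<lambda>u. \<tau> u * l u x)"
    and enn2real_marg: "enn2real (marg x) = (\<integral>u. l u x \<partial>m)"
    and updated_mean_eq: "(updated_mean x - c) * enn2real (marg x) = (\<integral>u. (\<tau> u - c) * l u x \<partial>m)"
proof -
  show 1: "integrable m (\<lambda>u. l u x)"
    using assms(1) l_pos unfolding marg_def by (intro integrableI_nonneg) (auto intro: less_imp_le)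
  show 2: "integrable m (\<lambda>u. \<tau> u * l u x)"
    using assms(2) l_pos unfolding abs_marg_def
    by (intro integrableI_bounded) (auto simp: abs_mult abs_of_pos)
  show 3: "enn2real (marg x) = (\<integral>u. l u x \<partial>m)"
    unfolding marg_def using l_pos by (subst integral_eq_nn_integral) (auto intro: less_imp_le)
  have "0 < enn2real (marg x)" using assms(1) marg_pos by (simp add: enn2real_positive_iff)
  then have "updated_mean x * enn2real (marg x) = (\<integral>u. \<tau> u * l u x \<partial>m)"
    using assms marg_pos by (simp add: updated_mean_def)
  then show "(updated_mean x - c) * enn2real (marg x) = (\<integral>u. (\<tau> u - c) * l u x \<partial>m)"
    using 1 2 3 by (simp add: left_diff_distrib)
qed

text \<open>A real-valued version of the density, as needed for Bochner integrals.\<close>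

lemma predictive_eq: "predictive = density R (\<lambda>x. ennreal (enn2real (marg x)))"
  unfolding predictive_def using AE_marg_finite by (intro density_cong) auto

text \<open>The tower property, localised to the event that the observation falls into \<open>C\<close>: integrate
  \<open>(\<tau> u - c) * l u x\<close> over \<open>C\<close> in both orders.\<close>

lemma
  assumes C[measurable]: "C \<in> sets borel"
  shows integrable_updated_mean: "integrable predictive (\<lambda>x. indicator C x * (updated_mean x - c))"
    and tower: "(\<integral>x. indicator C x * (updated_mean x - c) \<partial>predictive)
      = (\<integral>u. (\<tau> u - c) * measure (density R (\<lambda>x. ennreal (l u x))) C \<partial>m)"
proof -
  define h where "h u x = (\<tau> u - c) * (indicator C x * l u x)" for u x
  have h_meas[measurable]: "case_prod h \<in> borel_measurable (borel \<Otimes>\<^sub>M borel)"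
    unfolding h_def by measurable
  have "(\<integral>\<^sup>+u. (\<integral>\<^sup>+x. ennreal (norm (h u x)) \<partial>R) \<partial>m)
      \<le> (\<integral>\<^sup>+u. (\<integral>\<^sup>+x. ennreal \<bar>\<tau> u - c\<bar> * ennreal (l u x) \<partial>R) \<partial>m)"
    using l_pos by (intro nn_integral_mono)
      (auto simp: h_def abs_mult abs_of_pos indicator_def ennreal_mult')
  also have "\<dots> = (\<integral>\<^sup>+u. ennreal \<bar>\<tau> u - c\<bar> \<partial>m)"
    using l_one by (intro nn_integral_cong_AE) (auto simp: nn_integral_cmult)
  also have "\<dots> < \<infinity>"
  proof -
    have "integrable m (\<lambda>u. \<tau> u - c)" using \<tau>_int by simp
    then show ?thesis by (simp add: integrable_iff_bounded)
  qed
  finally have fin: "(\<integral>\<^sup>+u. (\<integral>\<^sup>+x. ennreal (norm (h u x)) \<partial>R) \<partial>m) < \<infinity>" .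
  have int: "integrable (m \<Otimes>\<^sub>M R) (case_prod h)"
  proof (rule integrableI_bounded)
    show "(\<integral>\<^sup>+p. ennreal (norm (case_prod h p)) \<partial>(m \<Otimes>\<^sub>M R)) < \<infinity>"
      using fin by (subst R.nn_integral_fst[symmetric]) (simp_all add: split_beta')
  qed simp
  have AE_eq: "AE x in R. (\<integral>u. h u x \<partial>m) = enn2real (marg x) * (indicator C x * (updated_mean x - c))"
    using AE_marg_finite
  proof eventually_elim
    case (elim x)
    have "h u x = indicator C x * ((\<tau> u - c) * l u x)" for u by (simp add: h_def)
    then have "(\<integral>u. h u x \<partial>m) = indicator C x * (\<integral>u. (\<tau> u - c) * l u x \<partial>m)"
      by (simp only: integral_mult_right_zero)
    then show ?case using updated_mean_eq[of x c] elim by (simp add: mult.assoc mult.commute)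
  qed
  have "integrable R (\<lambda>x. \<integral>u. h u x \<partial>m)" by (rule integrable_snd[OF int])
  then have "integrable R (\<lambda>x. enn2real (marg x) * (indicator C x * (updated_mean x - c)))"
    using AE_eq by (subst integrable_cong_AE[symmetric]) (auto simp: h_def)
  then show "integrable predictive (\<lambda>x. indicator C x * (updated_mean x - c))"
    unfolding predictive_eq by (subst integrable_density) auto
  have "(\<integral>x. indicator C x * (updated_mean x - c) \<partial>predictive)
      = (\<integral>x. enn2real (marg x) * (indicator C x * (updated_mean x - c)) \<partial>R)"
    unfolding predictive_eq by (subst integral_density) auto
  also have "\<dots> = (\<integral>x. (\<integral>u. h u x \<partial>m) \<partial>R)"
    using AE_eq by (intro integral_cong_AE) (auto simp: h_def)
  also have "\<dots> = (\<integral>u. (\<integral>x. h u x \<partial>R) \<partial>m)"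
    by (rule Fubini_integral[OF int])
  also have "\<dots> = (\<integral>u. (\<tau> u - c) * measure (density R (\<lambda>x. ennreal (l u x))) C \<partial>m)"
  proof (intro Bochner_Integration.integral_cong refl)
    fix u
    have "measure (density R (\<lambda>x. ennreal (l u x))) C = (\<integral>x. indicator C x * l u x \<partial>R)"
    proof -
      have "(\<integral>x. indicator C x * l u x \<partial>R) = enn2real (\<integral>\<^sup>+x. ennreal (indicator C x * l u x) \<partial>R)"
        using l_pos by (intro integral_eq_nn_integral AE_I2 mult_nonneg_nonneg) (auto intro: less_imp_le)
      also have "(\<integral>\<^sup>+x. ennreal (indicator C x * l u x) \<partial>R) = emeasure (density R (\<lambda>x. ennreal (l u x))) C"
        by (subst emeasure_density) (auto intro!: nn_integral_cong split: split_indicator)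
      finally show ?thesis by (simp add: measure_def)
    qed
    then show "(\<integral>x. h u x \<partial>R) = (\<tau> u - c) * measure (density R (\<lambda>x. ennreal (l u x))) C"
      by (simp add: h_def)
  qed
  finally show "(\<integral>x. indicator C x * (updated_mean x - c) \<partial>predictive)
      = (\<integral>u. (\<tau> u - c) * measure (density R (\<lambda>x. ennreal (l u x))) C \<partial>m)" .
qed

end

section \<open>The interpolated posterior\<close>

lemma supp_closed: "closed (supp \<mu>)"
proof -
  have "open (- supp \<mu>)"
  proof (subst open_subopen, rule ballI)
    fix u assume "u \<in> - supp \<mu>"
    then obtain U where "open U" "u \<in> U" "\<not> emeasure \<mu> U > 0" by (auto simp: supp_def)
    then show "\<exists>U. open U \<and> u \<in> U \<and> U \<subseteq> - supp \<mu>"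
      by (intro exI[of _ U]) (auto simp: supp_def)
  qed
  then show ?thesis by (simp add: closed_def)
qed

locale exp_family_prior = exp_family \<nu> for \<nu> +
  fixes \<mu> :: "real measure" and T :: "real \<Rightarrow> real" and t :: real
  assumes prob_\<mu>: "prob_space \<mu>" and sets_\<mu>[measurable_cong]: "sets \<mu> = sets borel"
    and supp_nat_dom: "supp \<mu> \<subseteq> nat_dom \<nu>"
    and T_mono: "mono_on (supp \<mu>) T" and T_int: "set_integrable \<mu> (supp \<mu>) T"
    and T_not_const: "\<not> (\<exists>c. AE u in \<mu>. u \<in> supp \<mu> \<longrightarrow> T u = c)"
begin

abbreviation S :: "real set" where "S \<equiv> supp \<mu>"

text \<open>Only the restriction of \<open>T\<close> to the support is measurable.\<close>

definition TS :: "real \<Rightarrow> real" where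
  "TS u = indicator S u * T u"

text \<open>The posterior for \<open>(t, y)\<close> is the normalised tilt of this measure by \<open>exp (u * y)\<close>.\<close>

definition base :: "real measure" where
  "base = density \<mu> (\<lambda>u. ennreal (indicator S u * exp (- t * cumulant \<nu> u)))"

lemma S_borel[measurable]: "S \<in> sets borel"
  using supp_closed by (simp add: borel_closed)

lemma space_\<mu>[simp]: "space \<mu> = UNIV"
  using sets_eq_imp_space_eq[OF sets_\<mu>] by simp

lemma TS_on_S: "u \<in> S \<Longrightarrow> TS u = T u"
  by (simp add: TS_def)

lemma TS_mono: "mono_on S TS"
  using T_mono by (simp add: mono_on_def TS_def)

lemma TS_meas[measurable]: "TS \<in> borel_measurable borel"
proof -
  have "(\<lambda>u. indicator S u *\<^sub>R T u) \<in> borel_measurable \<mu>"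
    using T_int unfolding set_integrable_def by (rule borel_measurable_integrable)
  then show ?thesis by (simp add: TS_def[abs_def] measurable_cong_sets[OF sets_\<mu> refl])
qed

text \<open>That \<open>\<mu>\<close> charges its support follows from \<open>T\<close> not being almost surely constant on it.\<close>

lemma not_AE_outside_S: "\<not> (AE u in \<mu>. u \<notin> S)"
proof
  assume "AE u in \<mu>. u \<notin> S"
  then have "AE u in \<mu>. u \<in> S \<longrightarrow> T u = 0" by eventually_elim simp
  then show False using T_not_const by blast
qed

lemma sets_base[measurable_cong, simp]: "sets base = sets borel"
  by (simp add: base_def sets_\<mu>)

lemma space_base[simp]: "space base = UNIV"
  by (simp add: base_def)

lemma AE_base_iff:
  assumes "Measurable.pred borel P"
  shows "(AE u in base. P u) \<longleftrightarrow> (AE u in \<mu>. u \<in> S \<longrightarrow> P u)"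
  unfolding base_def using assms
  by (subst AE_density) (auto simp: indicator_def intro!: AE_cong split: if_splits)

lemma AE_base_S: "AE u in base. u \<in> S"
  by (subst AE_base_iff) auto

lemma integral_exp_base_pos:
  assumes "integrable base (\<lambda>u. exp (u * y))"
  shows "0 < (\<integral>u. exp (u * y) \<partial>base)"
proof -
  have "(\<integral>u. exp (u * y) \<partial>base) \<noteq> 0"
  proof
    assume "(\<integral>u. exp (u * y) \<partial>base) = 0"
    then have "AE u in base. exp (u * y) = 0"
      using integral_nonneg_eq_0_iff_AE[OF assms] by simp
    then have "AE u in base. False" by simp
    then show False using not_AE_outside_S by (subst (asm) AE_base_iff) auto
  qed
  then show ?thesis by (simp add: less_le)
qed

lemma Y_dom_integrable:
  assumes "y \<in> Y_dom \<nu> \<mu> T t"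
  shows "integrable base (\<lambda>u. exp (u * y))" "integrable base (\<lambda>u. TS u * exp (u * y))"
proof -
  have fin: "(\<integral>\<^sup>+u. ennreal ((1 + \<bar>TS u\<bar>) * exp (u * y)) \<partial>base) < \<infinity>"
  proof -
    have "(\<integral>\<^sup>+u. ennreal ((1 + \<bar>TS u\<bar>) * exp (u * y)) \<partial>base)
        = (\<integral>\<^sup>+u. ennreal (indicator S u * exp (- t * cumulant \<nu> u)) * ennreal ((1 + \<bar>TS u\<bar>) * exp (u * y)) \<partial>\<mu>)"
      unfolding base_def by (rule nn_integral_density) simp_all
    also have "\<dots> = (\<integral>\<^sup>+u\<in>S. ennreal ((1 + \<bar>T u\<bar>) * tilt \<nu> t y u) \<partial>\<mu>)"
      by (intro nn_integral_cong)
        (auto simp: indicator_def TS_def tilt_def exp_diff exp_minus divide_inverse mult_ac simp flip: ennreal_mult')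
    also have "\<dots> < \<infinity>" using assms by (simp add: Y_dom_def)
    finally show ?thesis .
  qed
  have "(\<integral>\<^sup>+u. ennreal (norm (exp (u * y))) \<partial>base) \<le> (\<integral>\<^sup>+u. ennreal ((1 + \<bar>TS u\<bar>) * exp (u * y)) \<partial>base)"
    by (intro nn_integral_mono ennreal_leI) (simp add: algebra_simps)
  then show "integrable base (\<lambda>u. exp (u * y))"
    using fin by (intro integrableI_bounded) auto
  have "(\<integral>\<^sup>+u. ennreal (norm (TS u * exp (u * y))) \<partial>base) \<le> (\<integral>\<^sup>+u. ennreal ((1 + \<bar>TS u\<bar>) * exp (u * y)) \<partial>base)"
    by (intro nn_integral_mono ennreal_leI) (simp add: algebra_simps abs_mult)
  then show "integrable base (\<lambda>u. TS u * exp (u * y))"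
    using fin by (intro integrableI_bounded) auto
qed

context
  fixes y assumes y: "y \<in> Y_dom \<nu> \<mu> T t"
begin

lemmas exp_int = Y_dom_integrable(1)[OF y]
lemmas exp_pos = integral_exp_base_pos[OF exp_int]

lemma posterior_y_eq:
  "posterior_y \<nu> \<mu> t y = density base (\<lambda>u. ennreal (exp (u * y) / (\<integral>u. exp (u * y) \<partial>base)))"
proof -
  have Z: "(LINT u':S|\<mu>. tilt \<nu> t y u') = (\<integral>u. exp (u * y) \<partial>base)"
    unfolding base_def set_lebesgue_integral_def
    by (subst integral_density)
      (auto intro!: Bochner_Integration.integral_cong simp: tilt_def indicator_def exp_diff exp_minus divide_inverse)
  show ?thesis
    unfolding posterior_y_def Z unfolding base_def
    using exp_pos
    by (subst density_density_eq)
      (auto intro!: density_cong simp: tilt_def indicator_def exp_diff exp_minus divide_inverse base_def mult_ac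
        simp flip: ennreal_mult')
qed

lemma sets_posterior_y[measurable_cong, simp]: "sets (posterior_y \<nu> \<mu> t y) = sets borel"
  by (simp add: posterior_y_eq)

lemma AE_posterior_y_S: "AE u in posterior_y \<nu> \<mu> t y. u \<in> S"
  unfolding posterior_y_eq using AE_base_S by (subst AE_density) auto

lemma integrable_posterior_y:
  assumes [measurable]: "g \<in> borel_measurable borel"
  shows "integrable (posterior_y \<nu> \<mu> t y) g \<longleftrightarrow> integrable base (\<lambda>u. g u * exp (u * y))"
proof -
  have "integrable (posterior_y \<nu> \<mu> t y) g
      \<longleftrightarrow> integrable base (\<lambda>u. inverse (\<integral>u. exp (u * y) \<partial>base) * (g u * exp (u * y)))"
    unfolding posterior_y_eq using exp_pos
    by (subst integrable_density) (auto simp: divide_inverse mult_ac)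
  then show ?thesis using exp_pos by simp
qed

lemma integral_posterior_y:
  assumes [measurable]: "g \<in> borel_measurable borel"
  shows "(\<integral>u. g u \<partial>posterior_y \<nu> \<mu> t y) = tilt_mean base y g"
proof -
  have "(\<integral>u. g u \<partial>posterior_y \<nu> \<mu> t y)
      = (\<integral>u. inverse (\<integral>u. exp (u * y) \<partial>base) * (g u * exp (u * y)) \<partial>base)"
    unfolding posterior_y_eq using exp_pos
    by (subst integral_density) (auto simp: divide_inverse mult_ac)
  then show ?thesis by (simp add: tilt_mean_def divide_inverse mult.commute)
qed

lemma prob_space_posterior_y: "prob_space (posterior_y \<nu> \<mu> t y)"
proof
  have "emeasure (posterior_y \<nu> \<mu> t y) (space (posterior_y \<nu> \<mu> t y))
      = (\<integral>\<^sup>+u. ennreal (exp (u * y) / (\<integral>u. exp (u * y) \<partial>base)) \<partial>base)"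
    unfolding posterior_y_eq by (simp add: emeasure_density)
  also have "\<dots> = ennreal (\<integral>u. exp (u * y) / (\<integral>u. exp (u * y) \<partial>base) \<partial>base)"
    using exp_int exp_pos by (intro nn_integral_eq_integral) auto
  also have "\<dots> = 1" using exp_pos by simp
  finally show "emeasure (posterior_y \<nu> \<mu> t y) (space (posterior_y \<nu> \<mu> t y)) = 1" .
qed

lemma post_mean_eq_integral: "post_mean \<nu> \<mu> T t y = (\<integral>u. TS u \<partial>posterior_y \<nu> \<mu> t y)"
  by (simp add: post_mean_def set_lebesgue_integral_def TS_def)

lemma post_mean_eq: "post_mean \<nu> \<mu> T t y = tilt_mean base y TS"
  by (simp add: post_mean_eq_integral integral_posterior_y)

end

lemma post_mean_mono:
  assumes "y \<in> Y_dom \<nu> \<mu> T t" "y' \<in> Y_dom \<nu> \<mu> T t" "y \<le> y'"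
  shows "post_mean \<nu> \<mu> T t y \<le> post_mean \<nu> \<mu> T t y'"
  unfolding post_mean_eq[OF assms(1)] post_mean_eq[OF assms(2)]
  using assms by (intro tilt_mean_mono[OF AE_base_S TS_mono]) (auto intro: Y_dom_integrable exp_pos)

lemma post_mean_less:
  assumes y: "y \<in> Y_dom \<nu> \<mu> T t" "y' \<in> Y_dom \<nu> \<mu> T t" "y < y'"
  shows "post_mean \<nu> \<mu> T t y < post_mean \<nu> \<mu> T t y'"
proof (rule ccontr)
  assume "\<not> ?thesis"
  then have eq: "tilt_mean base y TS = tilt_mean base y' TS"
    using post_mean_mono[of y y'] y by (simp add: post_mean_eq)
  have "AE u in base. TS u = tilt_mean base y TS"
    using y by (intro tilt_mean_eq_imp_AE_const[OF AE_base_S TS_mono \<open>y < y'\<close> _ _ _ eq])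
      (auto intro: Y_dom_integrable exp_pos)
  then have "AE u in \<mu>. u \<in> S \<longrightarrow> TS u = tilt_mean base y TS" by (subst (asm) AE_base_iff) auto
  then have "AE u in \<mu>. u \<in> S \<longrightarrow> T u = tilt_mean base y TS"
    by eventually_elim (simp add: TS_on_S)
  then show False using T_not_const by blast
qed

lemma y_of_post_mean:
  assumes "y \<in> Y_dom \<nu> \<mu> T t"
  shows "y_of \<nu> \<mu> T t (post_mean \<nu> \<mu> T t y) = y"
  unfolding y_of_def
proof (rule the_equality)
  fix y' assume "y' \<in> Y_dom \<nu> \<mu> T t \<and> post_mean \<nu> \<mu> T t y' = post_mean \<nu> \<mu> T t y"
  then show "y' = y"
    using assms post_mean_less[of y y'] post_mean_less[of y' y] by (cases y y' rule: linorder_cases) auto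
qed (use assms in simp)

lemma posterior_post_mean:
  "y \<in> Y_dom \<nu> \<mu> T t \<Longrightarrow> posterior \<nu> \<mu> T t (post_mean \<nu> \<mu> T t y) = posterior_y \<nu> \<mu> t y"
  by (simp add: posterior_def y_of_post_mean)

end

section \<open>The transition operator\<close>

lemma upset_borel:
  fixes C :: "real set"
  assumes "\<And>x x'. x \<in> C \<Longrightarrow> x \<le> x' \<Longrightarrow> x' \<in> C"
  shows "C \<in> sets borel"
proof -
  have "mono (indicat_real C)" using assms by (auto intro!: monoI simp: indicator_def)
  then have "indicat_real C \<in> borel_measurable borel" by (rule borel_measurable_mono)
  then show ?thesis by (simp add: borel_measurable_indicator_iff)
qed

locale exp_family_update = exp_family_prior +
  fixes us :: real and k :: nat
  assumes us: "us \<in> nat_dom \<nu>"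
begin

abbreviation kernel :: "real \<Rightarrow> real measure" where
  "kernel \<equiv> trans_kernel \<nu> \<mu> T us t k"

text \<open>The probability that the sum of the observations falls into \<open>C\<close>. The form as a density makes it
  measurable in \<open>u\<close> on the whole line; on \<open>S\<close> it is the probability under \<open>sum_law\<close>.\<close>

abbreviation hit :: "real set \<Rightarrow> real \<Rightarrow> real" where
  "hit C u \<equiv> measure (density (sum_law \<nu> k us) (\<lambda>x. ennreal (lik_ratio \<nu> us k u x))) C"

lemma hit_eq: "u \<in> S \<Longrightarrow> hit C u = measure (sum_law \<nu> k u) C"
  using supp_nat_dom us by (subst sum_law_eq_density[of u us]) auto

lemma hit_meas[measurable]:
  assumes [measurable]: "C \<in> sets borel"
  shows "hit C \<in> borel_measurable borel"
proof -
  interpret R: prob_space "sum_law \<nu> k us" by (rule prob_space_sum_law[OF us])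
  have eq: "hit C = (\<lambda>u. enn2real (\<integral>\<^sup>+x. ennreal (lik_ratio \<nu> us k u x) * indicator C x \<partial>sum_law \<nu> k us))"
    unfolding measure_def by (intro ext, subst emeasure_density) auto
  show ?thesis unfolding eq by measurable
qed

context
  fixes y assumes y: "y \<in> Y_dom \<nu> \<mu> T t"
begin

interpretation bayes_update "posterior_y \<nu> \<mu> t y" "sum_law \<nu> k us" "lik_ratio \<nu> us k" TS "post_mean \<nu> \<mu> T t y"
proof (intro bayes_update.intro bayes_update_axioms.intro)
  show "AE u in posterior_y \<nu> \<mu> t y. (\<integral>\<^sup>+x. ennreal (lik_ratio \<nu> us k u x) \<partial>sum_law \<nu> k us) = 1"
    using AE_posterior_y_S[OF y]
  proof eventually_elim
    case (elim u)
    then have u: "u \<in> nat_dom \<nu>" using supp_nat_dom by blast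
    interpret prob_space "sum_law \<nu> k u" by (rule prob_space_sum_law[OF u])
    have "(\<integral>\<^sup>+x. ennreal (lik_ratio \<nu> us k u x) \<partial>sum_law \<nu> k us) = emeasure (sum_law \<nu> k u) UNIV"
      by (subst sum_law_eq_density[OF u us]) (simp add: emeasure_density)
    then show ?case using emeasure_space_1 by simp
  qed
  show "integrable (posterior_y \<nu> \<mu> t y) TS"
    using Y_dom_integrable[OF y] by (subst integrable_posterior_y[OF y]) auto
  show "case_prod (lik_ratio \<nu> us k) \<in> borel_measurable (borel \<Otimes>\<^sub>M borel)"
    by (rule measurable_lik_ratio)
qed (use y us in \<open>auto simp: lik_ratio_def prob_space_posterior_y prob_space_sum_law\<close>)

lemma rho_eq: "rho \<nu> \<mu> T us t k (post_mean \<nu> \<mu> T t y) x = marg x"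
  unfolding rho_def marg_def posterior_post_mean[OF y]
  using AE_posterior_y_S[OF y] by (intro nn_integral_cong_AE) auto

lemma eta_eq: "eta \<nu> \<mu> T us t k (post_mean \<nu> \<mu> T t y) x = abs_marg x"
  unfolding eta_def abs_marg_def posterior_post_mean[OF y]
  using AE_posterior_y_S[OF y] by (intro nn_integral_cong_AE) (auto simp: TS_on_S)

lemma next_mean_eq: "next_mean \<nu> \<mu> T us t k (post_mean \<nu> \<mu> T t y) = updated_mean"
proof
  fix x
  have "(LINT u:S|posterior_y \<nu> \<mu> t y. T u * lik_ratio \<nu> us k u x)
      = (\<integral>u. TS u * lik_ratio \<nu> us k u x \<partial>posterior_y \<nu> \<mu> t y)"
    by (simp add: set_lebesgue_integral_def TS_def mult.assoc)
  then show "next_mean \<nu> \<mu> T us t k (post_mean \<nu> \<mu> T t y) x = updated_mean x"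
    unfolding next_mean_def updated_mean_def rho_eq eta_eq posterior_post_mean[OF y] by (simp only:)
qed

lemma kernel_eq: "kernel (post_mean \<nu> \<mu> T t y) = distr predictive borel updated_mean"
proof -
  let ?K = "distr predictive borel updated_mean"
  have "trans_prob \<nu> \<mu> T us t k (post_mean \<nu> \<mu> T t y) C = emeasure ?K C" if [measurable]: "C \<in> sets borel" for C
  proof -
    have "trans_prob \<nu> \<mu> T us t k (post_mean \<nu> \<mu> T t y) C
        = (\<integral>\<^sup>+u. (\<integral>\<^sup>+x. indicator C (updated_mean x) \<partial>density (sum_law \<nu> k us) (\<lambda>x. ennreal (lik_ratio \<nu> us k u x)))
            \<partial>posterior_y \<nu> \<mu> t y)"
      unfolding trans_prob_def next_mean_eq posterior_post_mean[OF y]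
      using AE_posterior_y_S[OF y]
    proof (intro nn_integral_cong_AE, eventually_elim)
      case (elim u)
      then show ?case using sum_law_eq_density[of u us k] supp_nat_dom us by auto
    qed
    also have "\<dots> = (\<integral>\<^sup>+x. indicator C (updated_mean x) \<partial>predictive)"
      by (rule nn_integral_predictive) simp
    also have "\<dots> = (\<integral>\<^sup>+w. indicator C w \<partial>?K)"
      by (simp add: nn_integral_distr del: nn_integral_indicator)
    also have "\<dots> = emeasure ?K C" by simp
    finally show ?thesis .
  qed
  then have "kernel (post_mean \<nu> \<mu> T t y) = measure_of UNIV (sets borel) (emeasure ?K)"
    unfolding trans_kernel_def by (intro measure_of_eq) (auto simp: sets.sigma_sets_eq[of "borel :: real measure", simplified])
  also have "\<dots> = ?K" using measure_of_of_measure[of ?K] by simp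
  finally show ?thesis .
qed

lemma kernel_prob: "prob_space (kernel (post_mean \<nu> \<mu> T t y))"
  unfolding kernel_eq by (intro prob_space.prob_space_distr prob_space_predictive) simp

lemma kernel_sets: "sets (kernel (post_mean \<nu> \<mu> T t y)) = sets borel"
  unfolding kernel_eq by simp

lemma kernel_integrable_id: "integrable (kernel (post_mean \<nu> \<mu> T t y)) (\<lambda>w. w)"
  unfolding kernel_eq using integrable_updated_mean[of UNIV 0] by (subst integrable_distr_eq) auto

lemma hit_weighted_integral:
  assumes C[measurable]: "C \<in> sets borel"
  shows "(\<integral>x. indicator C x * (updated_mean x - c) \<partial>predictive) = tilt_mean base y (\<lambda>u. (TS u - c) * hit C u)"
  unfolding tower[OF C] by (rule integral_posterior_y[OF y]) simp

lemma hit_weighted_integrable: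
  assumes C[measurable]: "C \<in> sets borel"
  shows "integrable base (\<lambda>u. (TS u - c) * hit C u * exp (u * y))"
proof (rule Bochner_Integration.integrable_bound)
  show "integrable base (\<lambda>u. TS u * exp (u * y) - c * exp (u * y))"
    using Y_dom_integrable[OF y] by simp
  show "AE u in base. norm ((TS u - c) * hit C u * exp (u * y)) \<le> norm (TS u * exp (u * y) - c * exp (u * y))"
    using AE_base_S
  proof eventually_elim
    case (elim u)
    then interpret prob_space "sum_law \<nu> k u" using supp_nat_dom by (intro prob_space_sum_law) auto
    have "hit C u \<le> 1" using elim by (simp add: hit_eq)
    then have "\<bar>TS u - c\<bar> * hit C u * exp (u * y) \<le> \<bar>TS u - c\<bar> * 1 * exp (u * y)"
      by (intro mult_right_mono mult_left_mono) auto
    also have "\<dots> = norm (TS u * exp (u * y) - c * exp (u * y))"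
      by (simp add: abs_mult flip: left_diff_distrib)
    finally show ?case by (simp add: abs_mult)
  qed
qed simp

lemma kernel_mean: "(\<integral>w. w \<partial>kernel (post_mean \<nu> \<mu> T t y)) = post_mean \<nu> \<mu> T t y"
proof -
  have "(\<integral>w. w \<partial>kernel (post_mean \<nu> \<mu> T t y)) = (\<integral>x. indicator UNIV x * (updated_mean x - 0) \<partial>predictive)"
    unfolding kernel_eq by (subst integral_distr) auto
  also have "\<dots> = (\<integral>u. (TS u - 0) * hit UNIV u \<partial>posterior_y \<nu> \<mu> t y)"
    by (rule tower) simp
  also have "\<dots> = (\<integral>u. TS u \<partial>posterior_y \<nu> \<mu> t y)"
    using AE_posterior_y_S[OF y]
  proof (intro integral_cong_AE, simp, simp, eventually_elim)
    case (elim u)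
    then interpret prob_space "sum_law \<nu> k u" using supp_nat_dom by (intro prob_space_sum_law) auto
    show ?case using elim prob_space by (simp add: hit_eq)
  qed
  finally show ?thesis using post_mean_eq_integral[OF y] by simp
qed

text \<open>Deciding by an arbitrary event whether to collect \<open>M - c\<close> yields at most the positive part.\<close>

lemma kernel_hinge_ge_hit:
  assumes C[measurable]: "C \<in> sets borel"
  shows "tilt_mean base y (\<lambda>u. (TS u - c) * hit C u) \<le> (\<integral>w. max 0 (w - c) \<partial>kernel (post_mean \<nu> \<mu> T t y))"
proof -
  have "integrable predictive (\<lambda>x. updated_mean x - c)" using integrable_updated_mean[of UNIV c] by simp
  then have "tilt_mean base y (\<lambda>u. (TS u - c) * hit C u) \<le> (\<integral>x. max 0 (updated_mean x - c) \<partial>predictive)"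
    unfolding hit_weighted_integral[OF C, symmetric]
    by (intro integral_mono integrable_updated_mean integrable_max) (auto split: split_indicator)
  then show ?thesis unfolding kernel_eq by (subst integral_distr) auto
qed

text \<open>The best event is that the updated mean exceeds \<open>c\<close>. It is replaced by its upward closure \<open>C\<close>, which
  is an up-set without any condition on where the updated mean is finite. Nothing is lost: by the
  single-crossing property, a positive \<open>M - c\<close> at some observation keeps \<open>M - c\<close> nonnegative at all
  larger observations with finite marginals.\<close>

lemma kernel_hinge_eq_hit_upset:
  "\<exists>C\<in>sets borel. (\<forall>x\<in>C. \<forall>x'\<ge>x. x' \<in> C) \<and>
    (\<integral>w. max 0 (w - c) \<partial>kernel (post_mean \<nu> \<mu> T t y)) = tilt_mean base y (\<lambda>u. (TS u - c) * hit C u)"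
proof -
  define good where "good x \<longleftrightarrow> marg x < \<infinity> \<and> abs_marg x < \<infinity>" for x
  define C where "C = {x. \<exists>x'\<le>x. good x' \<and> c < updated_mean x'}"
  have up: "x' \<in> C" if "x \<in> C" "x \<le> x'" for x x' using that by (auto simp: C_def intro: order_trans)
  have C[measurable]: "C \<in> sets borel" using up by (rule upset_borel)
  \<comment> \<open>The likelihood is \<open>exp (u * x)\<close> up to factors depending on \<open>u\<close> or \<open>x\<close> alone, so a larger
    observation is a further tilt of the posterior.\<close>
  define w where "w u = exp (- (real k * (cumulant \<nu> u - cumulant \<nu> us)))" for u
  have l_eq: "lik_ratio \<nu> us k u x = exp (- (us * x)) * (w u * exp (u * x))" for u x
    by (simp add: lik_ratio_def w_def algebra_simps flip: exp_add)
  define \<xi> where "\<xi> u = (TS u - c) * w u" for u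
  have \<xi>: "integrable (posterior_y \<nu> \<mu> t y) (\<lambda>u. \<xi> u * exp (u * x))"
    "(updated_mean x - c) * enn2real (marg x) = exp (- (us * x)) * (\<integral>u. \<xi> u * exp (u * x) \<partial>posterior_y \<nu> \<mu> t y)"
    if "good x" for x
  proof -
    have eq: "(TS u - c) * lik_ratio \<nu> us k u x = exp (- (us * x)) * (\<xi> u * exp (u * x))" for u
      by (simp add: l_eq \<xi>_def)
    have "integrable (posterior_y \<nu> \<mu> t y) (\<lambda>u. (TS u - c) * lik_ratio \<nu> us k u x)"
      using that integrable_l[of x] integrable_\<tau>_l[of x] by (simp add: good_def left_diff_distrib)
    then show "integrable (posterior_y \<nu> \<mu> t y) (\<lambda>u. \<xi> u * exp (u * x))"
      unfolding eq by simp
    show "(updated_mean x - c) * enn2real (marg x) = exp (- (us * x)) * (\<integral>u. \<xi> u * exp (u * x) \<partial>posterior_y \<nu> \<mu> t y)"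
      using that updated_mean_eq[of x c] by (simp add: good_def eq)
  qed
  have marg_real_pos: "0 < enn2real (marg x)" if "good x" for x
    using that marg_pos[of x] by (simp add: good_def enn2real_positive_iff)
  have nonneg: "0 \<le> updated_mean x - c" if "x \<in> C" "good x" for x
  proof -
    obtain x' where x': "x' \<le> x" "good x'" "c < updated_mean x'" using \<open>x \<in> C\<close> by (auto simp: C_def)
    have "0 < (updated_mean x' - c) * enn2real (marg x')" using x' marg_real_pos by simp
    then have pos: "0 < (\<integral>u. \<xi> u * exp (u * x') \<partial>posterior_y \<nu> \<mu> t y)"
      using \<xi>(2)[OF x'(2)] by (simp add: zero_less_mult_iff)
    have "0 \<le> (\<integral>u. \<xi> u * exp (u * x) \<partial>posterior_y \<nu> \<mu> t y)"
    proof (rule exp_tilt_single_crossing[OF AE_posterior_y_S[OF y] _ x'(1) \<xi>(1)[OF x'(2)] \<xi>(1)[OF that(2)] pos])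
      show "0 \<le> \<xi> v" if "u \<in> S" "v \<in> S" "u < v" "0 < \<xi> u" for u v
        using that mono_onD[OF TS_mono, of u v] by (simp add: \<xi>_def w_def zero_less_mult_iff)
    qed
    then have "0 \<le> (updated_mean x - c) * enn2real (marg x)" using \<xi>(2)[OF that(2)] by simp
    then show ?thesis using marg_real_pos[OF that(2)] by (simp add: zero_le_mult_iff)
  qed
  have pointwise: "max 0 (updated_mean x - c) = indicator C x * (updated_mean x - c)" if "good x" for x
  proof (cases "x \<in> C")
    case True
    then show ?thesis using nonneg that by simp
  next
    case False
    then have "updated_mean x \<le> c" using that by (force simp: C_def)
    then show ?thesis using False by simp
  qed
  have "AE x in predictive. good x"
    unfolding predictive_def using AE_marg_finite by (subst AE_density) (auto simp: good_def)
  then have "AE x in predictive. max 0 (updated_mean x - c) = indicator C x * (updated_mean x - c)"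
    by eventually_elim (rule pointwise)
  then have "(\<integral>x. max 0 (updated_mean x - c) \<partial>predictive) = (\<integral>x. indicator C x * (updated_mean x - c) \<partial>predictive)"
    by (intro integral_cong_AE) auto
  then have "(\<integral>w. max 0 (w - c) \<partial>kernel (post_mean \<nu> \<mu> T t y)) = tilt_mean base y (\<lambda>u. (TS u - c) * hit C u)"
    unfolding kernel_eq hit_weighted_integral[OF C] by (subst integral_distr) auto
  then show ?thesis using C up by blast
qed

end

text \<open>The optimal event at the middle point \<open>z0\<close> is tested against the two outer points.\<close>

lemma kernel_hinge_convex:
  assumes J: "convex J" "J \<subseteq> Z_dom \<nu> \<mu> T t"
  shows "convex_on J (\<lambda>z. \<integral>w. max 0 (w - c) \<partial>kernel z)"
proof (rule convex_on_linorderI)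
  fix s z1 z3 :: real
  assume s: "0 < s" "s < 1" and z: "z1 \<in> J" "z3 \<in> J" "z1 < z3"
  define z0 where "z0 = (1 - s) * z1 + s * z3"
  have "z0 \<in> J" using convexD_alt[OF J(1) z(1,2), of s] s by (simp add: z0_def)
  have z0: "z1 < z0" "z0 < z3"
  proof -
    have "0 < s * (z3 - z1)" "0 < (1 - s) * (z3 - z1)" using s z by simp_all
    then show "z1 < z0" "z0 < z3" by (simp_all add: z0_def algebra_simps)
  qed
  have "\<exists>y. y \<in> Y_dom \<nu> \<mu> T t \<and> post_mean \<nu> \<mu> T t y = z" if "z \<in> J" for z
    using J(2) that by (auto simp: Z_dom_def)
  from this[OF z(1)] this[OF \<open>z0 \<in> J\<close>] this[OF z(2)]
  obtain y1 y0 y3 where y: "y1 \<in> Y_dom \<nu> \<mu> T t" "y0 \<in> Y_dom \<nu> \<mu> T t" "y3 \<in> Y_dom \<nu> \<mu> T t"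
    and pm: "post_mean \<nu> \<mu> T t y1 = z1" "post_mean \<nu> \<mu> T t y0 = z0" "post_mean \<nu> \<mu> T t y3 = z3"
    by blast
  have less: "y1 < y0" "y0 < y3"
    using post_mean_mono[of y0 y1] post_mean_mono[of y3 y0] y pm z0 by linarith+
  define F where "F v = (\<integral>w. max 0 (w - c) \<partial>kernel (post_mean \<nu> \<mu> T t v))" for v
  obtain C where C[measurable]: "C \<in> sets borel" and up: "\<And>x x'. x \<in> C \<Longrightarrow> x \<le> x' \<Longrightarrow> x' \<in> C"
    and F0: "F y0 = tilt_mean base y0 (\<lambda>u. (TS u - c) * hit C u)"
    using kernel_hinge_eq_hit_upset[OF y(2), of c] unfolding F_def by blast
  have in_Y: "v \<in> Y_dom \<nu> \<mu> T t" if "v \<in> {y1, y0, y3}" for v using that y by auto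
  have "F y0 \<le> (1 - s) * F y1 + s * F y3"
  proof (rule hinge_below_chord[where m = base and S = S and T = TS and p = "hit C" and c = c and F = F])
    show "mono_on S (hit C)"
    proof (rule mono_onI)
      fix u v assume "u \<in> S" "v \<in> S" "u \<le> v"
      then show "hit C u \<le> hit C v"
        using sum_law_upset_mono[where u = u and v = v and C = C and k = k] C up supp_nat_dom
        by (auto simp: hit_eq)
    qed
    show "0 \<le> hit C u" for u by simp
    show "hit C u \<le> 1" if "u \<in> S" for u
    proof -
      interpret prob_space "sum_law \<nu> k u" using supp_nat_dom that by (intro prob_space_sum_law) auto
      show ?thesis using that by (simp add: hit_eq)
    qed
    show "tilt_mean base y0 TS = (1 - s) * tilt_mean base y1 TS + s * tilt_mean base y3 TS"
      "tilt_mean base y1 TS < tilt_mean base y3 TS"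
      using pm z by (simp_all add: z0_def post_mean_eq y)
    fix v assume "v \<in> {y1, y0, y3}"
    note v = in_Y[OF this]
    show "integrable base (\<lambda>u. exp (u * v))" "integrable base (\<lambda>u. TS u * exp (u * v))"
      by (rule Y_dom_integrable[OF v])+
    show "integrable base (\<lambda>u. (TS u - c) * hit C u * exp (u * v))"
      by (rule hit_weighted_integrable[OF v C])
    show "0 < (\<integral>u. exp (u * v) \<partial>base)" by (rule exp_pos[OF v])
    show "0 \<le> F v" unfolding F_def by (rule integral_nonneg_AE) simp
    show "tilt_mean base v TS - c \<le> F v"
    proof -
      interpret prob_space "kernel (post_mean \<nu> \<mu> T t v)" by (rule kernel_prob[OF v])
      have "(\<integral>w. w - c \<partial>kernel (post_mean \<nu> \<mu> T t v)) \<le> F v"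
        unfolding F_def using kernel_integrable_id[OF v]
        by (intro integral_mono integrable_max) auto
      moreover have "(\<integral>w. w - c \<partial>kernel (post_mean \<nu> \<mu> T t v)) = post_mean \<nu> \<mu> T t v - c"
        using kernel_integrable_id[OF v] kernel_mean[OF v] prob_space by simp
      ultimately show ?thesis using post_mean_eq[OF v] by simp
    qed
    show "tilt_mean base v (\<lambda>u. (TS u - c) * hit C u) \<le> F v"
      unfolding F_def by (rule kernel_hinge_ge_hit[OF v C])
  qed (fact AE_base_S TS_mono less s F0)+
  then show "(\<integral>w. max 0 (w - c) \<partial>kernel ((1 - s) *\<^sub>R z1 + s *\<^sub>R z3))
      \<le> (1 - s) * (\<integral>w. max 0 (w - c) \<partial>kernel z1) + s * (\<integral>w. max 0 (w - c) \<partial>kernel z3)"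
    using pm by (simp add: F_def z0_def)
qed (rule J(1))

lemma trans_op_convex:
  assumes J: "convex J" "J \<subseteq> Z_dom \<nu> \<mu> T t" and f: "convex_on UNIV f"
    and fin: "\<And>z. z \<in> J \<Longrightarrow> trans_op_nn \<nu> \<mu> T us t k (\<lambda>w. ennreal \<bar>f w\<bar>) z < \<infinity>"
  shows "convex_on J (\<lambda>z. trans_op \<nu> \<mu> T us t k f z)"
  unfolding trans_op_def
proof (rule convex_on_integral_from_hinges[OF J(1) _ _ _ _ kernel_hinge_convex[OF J] f])
  have f_meas: "f \<in> borel_measurable borel"
    using convex_on_continuous[OF open_UNIV f] by (rule borel_measurable_continuous_onI)
  fix z assume "z \<in> J"
  then obtain y where y: "y \<in> Y_dom \<nu> \<mu> T t" "z = post_mean \<nu> \<mu> T t y"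
    using J(2) by (auto simp: Z_dom_def)
  show "prob_space (kernel z)" "sets (kernel z) = sets borel" "integrable (kernel z) (\<lambda>w. w)"
    "(\<integral>w. w \<partial>kernel z) = z"
    using y kernel_prob kernel_sets kernel_integrable_id kernel_mean by auto
  show "integrable (kernel z) f"
    using fin[OF \<open>z \<in> J\<close>] f_meas \<open>sets (kernel z) = sets borel\<close>
    by (intro integrableI_bounded) (auto simp: trans_op_nn_def measurable_cong_sets[OF \<open>sets (kernel z) = sets borel\<close> refl])
qed

end

text \<open>The weight \<open>1 + u\<^sup>2\<close> is at least one.\<close>

lemma Z2_dom_subset: "Z2_dom \<nu> \<mu> T t \<subseteq> Z_dom \<nu> \<mu> T t"
proof -
  have "Y2_dom \<nu> \<mu> T t \<subseteq> Y_dom \<nu> \<mu> T t"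
  proof
    fix y assume "y \<in> Y2_dom \<nu> \<mu> T t"
    then have fin: "(\<integral>\<^sup>+u\<in>supp \<mu>. ennreal ((1 + \<bar>T u\<bar>) * (1 + u\<^sup>2) * tilt \<nu> t y u) \<partial>\<mu>) < \<infinity>"
      using interior_subset by (fastforce simp: Y2_dom_def)
    have "(1 + \<bar>T u\<bar>) * tilt \<nu> t y u \<le> (1 + \<bar>T u\<bar>) * (1 + u\<^sup>2) * tilt \<nu> t y u" for u
      by (rule mult_right_mono) (auto simp: tilt_def algebra_simps)
    then have "(\<integral>\<^sup>+u\<in>supp \<mu>. ennreal ((1 + \<bar>T u\<bar>) * tilt \<nu> t y u) \<partial>\<mu>)
        \<le> (\<integral>\<^sup>+u\<in>supp \<mu>. ennreal ((1 + \<bar>T u\<bar>) * (1 + u\<^sup>2) * tilt \<nu> t y u) \<partial>\<mu>)"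
      by (intro nn_integral_mono mult_right_mono) (auto intro: ennreal_leI)
    then show "y \<in> Y_dom \<nu> \<mu> T t" using fin by (simp add: Y_dom_def)
  qed
  then show ?thesis by (auto simp: Z2_dom_def Z_dom_def)
qed

theorem theorem3p2:
  fixes \<nu> \<mu> :: "real measure" and T f :: "real \<Rightarrow> real" and us t :: real and k :: nat
    and J :: "real set"
  assumes "sigma_finite_measure \<nu>" and "sets \<nu> = sets borel"
    and nondegenerate: "\<And>u. u \<in> interior (nat_dom \<nu>) \<Longrightarrow>
          prob_space.variance (exp_law \<nu> u) (\<lambda>x. x) > 0"
    and "prob_space \<mu>" and "sets \<mu> = sets borel"
    and "supp \<mu> \<subseteq> interior (nat_dom \<nu>)"
    and "mono_on (supp \<mu>) T" and "set_integrable \<mu> (supp \<mu>) T"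
    and not_const: "\<not> (\<exists>c. AE u in \<mu>. u \<in> supp \<mu> \<longrightarrow> T u = c)"
    and "us \<in> interior (nat_dom \<nu>)"
    and "t \<ge> 0" and "k \<ge> 1"
    and "open J" and "is_interval J" and "J \<noteq> {}" and "J \<subseteq> Z2_dom \<nu> \<mu> T t"
    and "convex_on UNIV f"
    and "\<And>z. z \<in> J \<Longrightarrow> trans_op_nn \<nu> \<mu> T us t k (\<lambda>w. ennreal \<bar>f w\<bar>) z < \<infinity>"
  shows "convex_on J (\<lambda>z. trans_op \<nu> \<mu> T us t k f z)"
proof -
  \<comment> \<open>For the zero measure all variances would be zero.\<close>
  have "emeasure \<nu> UNIV \<noteq> 0"
  proof
    assume "emeasure \<nu> UNIV = 0"
    then have "AE x in \<nu>. False"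
      using sets_eq_imp_space_eq[OF \<open>sets \<nu> = sets borel\<close>] \<open>sets \<nu> = sets borel\<close>
      by (subst AE_iff_measurable[of UNIV]) auto
    then have "AE x in exp_law \<nu> us. False"
      unfolding exp_law_def using \<open>sets \<nu> = sets borel\<close> by (subst AE_density) auto
    then have "(\<integral>x. (x - c)\<^sup>2 \<partial>exp_law \<nu> us) = 0" for c
      by (intro integral_eq_zero_AE) auto
    then show False using nondegenerate[OF \<open>us \<in> interior (nat_dom \<nu>)\<close>] by simp
  qed
  then interpret exp_family_update \<nu> \<mu> T t us k
    using assms interior_subset[of "nat_dom \<nu>"]
    by (intro exp_family_update.intro exp_family_prior.intro exp_family.intro
        exp_family_prior_axioms.intro exp_family_update_axioms.intro) (assumption | blast)+
  show ?thesis
  proof (rule trans_op_convex)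
    show "convex J" using \<open>is_interval J\<close> by (simp add: is_interval_convex)
    show "J \<subseteq> Z_dom \<nu> \<mu> T t" using \<open>J \<subseteq> Z2_dom \<nu> \<mu> T t\<close> Z2_dom_subset by blast
  qed (use assms in auto)
qed

end
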